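(* Assume that $R$ is not isomorphic to $R^*$. Then every $G_0$-equivariant endomorphism of $V\oplus V^*$, transported via $\varepsilon$, has the form $(\mathsf A\otimes\mathrm{Id}_R)\oplus(\mathsf D\otimes\mathrm{Id}_{R^*})$ with $\mathsf A\in\mathrm{End}(H)$ and $\mathsf D\in\mathrm{End}(H^* )$. Such a map respects the canonical symmetric bilinear form $b$ on $V\oplus V^*$ if and only if $\mathsf A\oplus\mathsf D\in\mathrm{End}(H\oplus H^* )$ respects the canonical symmetric bilinear form \[s(h_1+f_1,h_2+f_2)=f_1(h_2)+f_2(h_1)\] on $H\oplus H^*$.
   Context: Setting: - $G_0$ is a compact group, and $R$ is a finite-dimensional irreducible unitary $G_0$-representation. - $V$ is a finite-dimensional unitary $G_0$-representation all of whose irreducible subrepresentations are isomorphic to $R$. Duals carry the action $g(f)=f\circ g^{-1}$. - $b(v_1+f_1,v_2+f_2)=f_1(v_2)+f_2(v_1)$ on $V\oplus V^*$. - $H=\mathrm{Hom}_{G_0}(R,V)$, $H^*=\mathrm{Hom}_{G_0}(R^*,V^* )$, and $\varepsilon:(H\otimes R)\oplus(H^*\otimes R^* )\to V\oplus V^*$, $h\otimes r+f\otimes t\mapsto h(r)+f(t)$, which is a $G_0$-equivariant isomorphism. - $H^*$ is paired with $H$ by $f(h)=\sum_i f(\vartheta_i)(h(e_i))$, where $(e_i)$ is a basis of $R$ and $(\vartheta_i)$ is the dual basis. A linear map $M$ respects a bilinear form $F$ in either of two senses: (i) as an isometry, $F(Mw_1,Mw_2)=F(w_1,w_2)$ (for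 invertible $M$); or (ii) infinitesimally, $F(Mw_1,w_2)+F(w_1,Mw_2)=0$. The equivalence holds in each sense. *)

theory Defs
  imports "HOL-Analysis.Analysis" "HOL-Algebra.Group" "Jordan_Normal_Form.Matrix"
begin

(* A compact (Hausdorff) topological group: HOL-Algebra group G with a topology on its carrier *)
definition compact_group :: "('g, 'b) monoid_scheme \<Rightarrow> 'g topology \<Rightarrow> bool" where
  "compact_group G T \<longleftrightarrow> group G \<and> topspace T = carrier G \<and> compact_space T \<and> Hausdorff_space T
     \<and> continuous_map (prod_topology T T) T (\<lambda>(x, y). x \<otimes>\<^bsub>G\<^esub> y)
     \<and> continuous_map T T (\<lambda>x. inv\<^bsub>G\<^esub> x)"

(* conjugate transpose and unitary matrices *)
definition ctrans :: "complex mat \<Rightarrow> complex mat" where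
  "ctrans M = map_mat cnj (transpose_mat M)"

definition unitary_mat :: "nat \<Rightarrow> complex mat \<Rightarrow> bool" where
  "unitary_mat n M \<longleftrightarrow> M \<in> carrier_mat n n \<and> M * ctrans M = 1\<^sub>m n"

(* A continuous unitary representation of (G,T) on C^n, given by matrices
   with respect to an orthonormal basis *)
definition unitary_rep :: "('g, 'b) monoid_scheme \<Rightarrow> 'g topology \<Rightarrow> nat \<Rightarrow> ('g \<Rightarrow> complex mat) \<Rightarrow> bool" where
  "unitary_rep G T n \<rho> \<longleftrightarrow>
     (\<forall>g\<in>carrier G. unitary_mat n (\<rho> g))
     \<and> (\<forall>g\<in>carrier G. \<forall>h\<in>carrier G. \<rho> (g \<otimes>\<^bsub>G\<^esub> h) = \<rho> g * \<rho> h)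
     \<and> \<rho> \<one>\<^bsub>G\<^esub> = 1\<^sub>m n
     \<and> (\<forall>i<n. \<forall>j<n. continuous_map T euclidean (\<lambda>g. \<rho> g $$ (i, j)))"

(* dual representation, in coordinates w.r.t. the dual basis: (g f)(v) = f(g^{-1} v) *)
definition dual_rep :: "('g, 'b) monoid_scheme \<Rightarrow> ('g \<Rightarrow> complex mat) \<Rightarrow> 'g \<Rightarrow> complex mat" where
  "dual_rep G \<rho> g = transpose_mat (\<rho> (inv\<^bsub>G\<^esub> g))"

(* complex subspaces and complex-linear maps *)
definition csubspace_of :: "nat \<Rightarrow> complex vec set \<Rightarrow> bool" where
  "csubspace_of n W \<longleftrightarrow> W \<subseteq> carrier_vec n \<and> 0\<^sub>v n \<in> W
     \<and> (\<forall>x\<in>W. \<forall>y\<in>W. x + y \<in> W) \<and> (\<forall>c. \<forall>x\<in>W. c \<cdot>\<^sub>v x \<in> W)"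

definition invariant_subspace :: "('g, 'b) monoid_scheme \<Rightarrow> nat \<Rightarrow> ('g \<Rightarrow> complex mat) \<Rightarrow> complex vec set \<Rightarrow> bool" where
  "invariant_subspace G n \<rho> W \<longleftrightarrow> csubspace_of n W \<and> (\<forall>g\<in>carrier G. \<forall>w\<in>W. \<rho> g *\<^sub>v w \<in> W)"

(* W is an irreducible subrepresentation of (C^n, rho) *)
definition irreducible_subrep :: "('g, 'b) monoid_scheme \<Rightarrow> nat \<Rightarrow> ('g \<Rightarrow> complex mat) \<Rightarrow> complex vec set \<Rightarrow> bool" where
  "irreducible_subrep G n \<rho> W \<longleftrightarrow> invariant_subspace G n \<rho> W \<and> W \<noteq> {0\<^sub>v n}
     \<and> (\<forall>U. invariant_subspace G n \<rho> U \<and> U \<subseteq> W \<longrightarrow> U = {0\<^sub>v n} \<or> U = W)"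

definition irreducible_rep :: "('g, 'b) monoid_scheme \<Rightarrow> nat \<Rightarrow> ('g \<Rightarrow> complex mat) \<Rightarrow> bool" where
  "irreducible_rep G n \<rho> \<longleftrightarrow> irreducible_subrep G n \<rho> (carrier_vec n)"

(* (C^n, rho) is isomorphic to the subrepresentation W of (C^m, sigma) *)
definition rep_iso_to :: "('g, 'b) monoid_scheme \<Rightarrow> nat \<Rightarrow> ('g \<Rightarrow> complex mat) \<Rightarrow> nat \<Rightarrow> ('g \<Rightarrow> complex mat) \<Rightarrow> complex vec set \<Rightarrow> bool" where
  "rep_iso_to G n \<rho> m \<sigma> W \<longleftrightarrow> (\<exists>\<phi>. bij_betw \<phi> (carrier_vec n) W
     \<and> (\<forall>x\<in>carrier_vec n. \<forall>y\<in>carrier_vec n. \<phi> (x + y) = \<phi> x + \<phi> y)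
     \<and> (\<forall>c. \<forall>x\<in>carrier_vec n. \<phi> (c \<cdot>\<^sub>v x) = c \<cdot>\<^sub>v \<phi> x)
     \<and> (\<forall>g\<in>carrier G. \<forall>x\<in>carrier_vec n. \<phi> (\<rho> g *\<^sub>v x) = \<sigma> g *\<^sub>v \<phi> x))"

(* H = Hom_G(R,V), as m x r matrices *)
definition hom_space :: "('g, 'b) monoid_scheme \<Rightarrow> nat \<Rightarrow> ('g \<Rightarrow> complex mat) \<Rightarrow> nat \<Rightarrow> ('g \<Rightarrow> complex mat) \<Rightarrow> complex mat set" where
  "hom_space G r \<rho> m \<sigma> = {h \<in> carrier_mat m r. \<forall>g\<in>carrier G. h * \<rho> g = \<sigma> g * h}"

(* the pairing H* x H -> C:  f(h) = sum_i f(theta_i)(h(e_i)) *)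
definition hom_pairing :: "nat \<Rightarrow> complex mat \<Rightarrow> complex mat \<Rightarrow> complex" where
  "hom_pairing r f h = (\<Sum>i<r. (f *\<^sub>v unit_vec r i) \<bullet> (h *\<^sub>v unit_vec r i))"

(* canonical symmetric form b on V + V* *)
definition form_b :: "complex vec \<times> complex vec \<Rightarrow> complex vec \<times> complex vec \<Rightarrow> complex" where
  "form_b w1 w2 = snd w1 \<bullet> fst w2 + snd w2 \<bullet> fst w1"

(* canonical symmetric form s on H + H* *)
definition form_s :: "nat \<Rightarrow> complex mat \<times> complex mat \<Rightarrow> complex mat \<times> complex mat \<Rightarrow> complex" where
  "form_s r w1 w2 = hom_pairing r (snd w1) (fst w2) + hom_pairing r (snd w2) (fst w1)"

(* complex linearity of a map on a product of (subspaces), expressed componentwise *)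
definition clinear_on :: "'a set \<Rightarrow> ('a \<Rightarrow> 'b) \<Rightarrow> ('a \<Rightarrow> 'a \<Rightarrow> 'a) \<Rightarrow> (complex \<Rightarrow> 'a \<Rightarrow> 'a)
     \<Rightarrow> ('b \<Rightarrow> 'b \<Rightarrow> 'b) \<Rightarrow> (complex \<Rightarrow> 'b \<Rightarrow> 'b) \<Rightarrow> bool" where
  "clinear_on S f pl sm pl' sm' \<longleftrightarrow> (\<forall>x\<in>S. \<forall>y\<in>S. f (pl x y) = pl' (f x) (f y))
     \<and> (\<forall>c. \<forall>x\<in>S. f (sm c x) = sm' c (f x))"

definition vpair_add :: "complex vec \<times> complex vec \<Rightarrow> complex vec \<times> complex vec \<Rightarrow> complex vec \<times> complex vec" where
  "vpair_add x y = (fst x + fst y, snd x + snd y)"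
definition vpair_smult :: "complex \<Rightarrow> complex vec \<times> complex vec \<Rightarrow> complex vec \<times> complex vec" where
  "vpair_smult c x = (c \<cdot>\<^sub>v fst x, c \<cdot>\<^sub>v snd x)"

(* respecting a bilinear form F on S: (i) as an invertible isometry, (ii) infinitesimally *)
definition respects_isometry :: "'a set \<Rightarrow> ('a \<Rightarrow> 'a \<Rightarrow> complex) \<Rightarrow> ('a \<Rightarrow> 'a) \<Rightarrow> bool" where
  "respects_isometry S F M \<longleftrightarrow> bij_betw M S S \<and> (\<forall>w1\<in>S. \<forall>w2\<in>S. F (M w1) (M w2) = F w1 w2)"

definition respects_infinitesimally :: "'a set \<Rightarrow> ('a \<Rightarrow> 'a \<Rightarrow> complex) \<Rightarrow> ('a \<Rightarrow> 'a) \<Rightarrow> bool" where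
  "respects_infinitesimally S F M \<longleftrightarrow> (\<forall>w1\<in>S. \<forall>w2\<in>S. F (M w1) w2 + F w1 (M w2) = 0)"

end

theory Submission
  imports Defs "Jordan_Normal_Form.Gram_Schmidt"
begin

(* Write \<Phi> in block form with respect to V \<oplus> V\<^sup>*. Equivariance makes every block an
   intertwiner. The off-diagonal blocks vanish: composed with elements of H and their transposes they
   give intertwiners between R and its dual, which are zero by Schur's lemma because R is not
   self-dual, and the images of the elements of H span V by complete reducibility. Hence \<Phi> is
   block diagonal, given by an equivariant endomorphism MV of V and MD of its dual, and A, D are
   left multiplication by MV, MD. Both kinds of compatibility then reduce to the same matrix
   identities, MD\<^sup>T MV = 1 for isometries and MD\<^sup>T + MV = 0 infinitesimally: for b this
   is plain linear algebra, for s it holds because the pairing of the dual hom-space with H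
   separates equivariant endomorphisms N of V, as pairing N h against its own conjugate gives a
   sum of squares. *)

unbundle no vec_syntax
no_notation inner (infix "\<bullet>" 70)

section \<open>Matrices and linear maps\<close>

lemma mult_mat_vec_zero: "A \<in> carrier_mat k n \<Longrightarrow> A *\<^sub>v 0\<^sub>v n = 0\<^sub>v k"
  by auto

lemma zero_mat_mult_vec: "x \<in> carrier_vec n \<Longrightarrow> 0\<^sub>m k n *\<^sub>v x = 0\<^sub>v k"
  by (intro eq_vecI) auto

lemma eq_mat_by_mult_vecI:
  fixes A B :: "'a::comm_ring_1 mat"
  assumes A: "A \<in> carrier_mat m n" and B: "B \<in> carrier_mat m n"
    and eq: "\<And>x. x \<in> carrier_vec n \<Longrightarrow> A *\<^sub>v x = B *\<^sub>v x"
  shows "A = B"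
proof (rule eq_matI)
  fix i j assume "i < dim_row B" "j < dim_col B"
  with B have ij: "i < m" "j < n" by auto
  have "A $$ (i, j) = (A *\<^sub>v unit_vec n j) $ i" using A ij by simp
  also have "\<dots> = (B *\<^sub>v unit_vec n j) $ i" using eq ij by simp
  also have "\<dots> = B $$ (i, j)" using B ij by simp
  finally show "A $$ (i, j) = B $$ (i, j)" .
qed (use A B in auto)

lemma eq_mat_by_scalar_prodI:
  fixes N1 N2 :: "'a::comm_ring_1 mat"
  assumes N1: "N1 \<in> carrier_mat m m" and N2: "N2 \<in> carrier_mat m m"
    and eq: "\<And>f v. f \<in> carrier_vec m \<Longrightarrow> v \<in> carrier_vec m \<Longrightarrow> f \<bullet> (N1 *\<^sub>v v) = f \<bullet> (N2 *\<^sub>v v)"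
  shows "N1 = N2"
proof (rule eq_mat_by_mult_vecI[OF N1 N2])
  fix v :: "'a vec" assume v: "v \<in> carrier_vec m"
  show "N1 *\<^sub>v v = N2 *\<^sub>v v"
  proof (rule eq_vecI)
    fix i assume "i < dim_vec (N2 *\<^sub>v v)"
    then have "i < m" using N2 by simp
    then show "(N1 *\<^sub>v v) $ i = (N2 *\<^sub>v v) $ i" using eq[of "unit_vec m i" v] N1 N2 v by simp
  qed (use N1 N2 in simp)
qed

lemma linear_map_is_mult_mat_vec:
  fixes f :: "'a::field vec \<Rightarrow> 'a vec"
  assumes carrier: "\<And>x. x \<in> carrier_vec n \<Longrightarrow> f x \<in> carrier_vec m"
    and add: "\<And>x y. x \<in> carrier_vec n \<Longrightarrow> y \<in> carrier_vec n \<Longrightarrow> f (x + y) = f x + f y"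
    and smult: "\<And>c x. x \<in> carrier_vec n \<Longrightarrow> f (c \<cdot>\<^sub>v x) = c \<cdot>\<^sub>v f x"
  obtains M where "M \<in> carrier_mat m n" "\<And>x. x \<in> carrier_vec n \<Longrightarrow> f x = M *\<^sub>v x"
proof -
  define M where "M = mat m n (\<lambda>(i, j). f (unit_vec n j) $ i)"
  have M: "M \<in> carrier_mat m n" by (simp add: M_def)
  have unit: "M *\<^sub>v unit_vec n j = f (unit_vec n j)" if "j < n" for j
    using that carrier[of "unit_vec n j"] by (intro eq_vecI) (auto simp: M_def)
  have truncated: "f (vec n (\<lambda>j. if j < k then x $ j else 0)) = M *\<^sub>v vec n (\<lambda>j. if j < k then x $ j else 0)"
    if "x \<in> carrier_vec n" "k \<le> n" for x k
    using that(2)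
  proof (induction k)
    case 0
    have "f (0\<^sub>v n) = f (0 \<cdot>\<^sub>v 0\<^sub>v n)" by (intro arg_cong[of _ _ f] eq_vecI) auto
    also have "\<dots> = 0\<^sub>v m" using smult[of "0\<^sub>v n" 0] carrier[of "0\<^sub>v n"] by auto
    finally show ?case using mult_mat_vec_zero[OF M] by (simp add: zero_vec_def[symmetric])
  next
    case (Suc k)
    let ?p = "vec n (\<lambda>j. if j < k then x $ j else 0)"
    have split: "vec n (\<lambda>j. if j < Suc k then x $ j else 0) = ?p + x $ k \<cdot>\<^sub>v unit_vec n k"
      by (rule eq_vecI) (auto simp: unit_vec_def less_Suc_eq)
    have "f (?p + x $ k \<cdot>\<^sub>v unit_vec n k) = M *\<^sub>v ?p + x $ k \<cdot>\<^sub>v (M *\<^sub>v unit_vec n k)"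
      using Suc add smult unit by simp
    also have "\<dots> = M *\<^sub>v (?p + x $ k \<cdot>\<^sub>v unit_vec n k)"
      using M Suc by (simp add: mult_add_distrib_mat_vec mult_mat_vec)
    finally show ?case unfolding split .
  qed
  have "f x = M *\<^sub>v x" if x: "x \<in> carrier_vec n" for x
  proof -
    have "vec n (\<lambda>j. if j < n then x $ j else 0) = x" using x by auto
    with truncated[OF x order.refl] show ?thesis by simp
  qed
  with M show thesis by (rule that)
qed

lemma scalar_prod_mult_mat_vec:
  fixes A :: "'a::comm_semiring_0 mat"
  assumes A: "A \<in> carrier_mat n k" and x: "x \<in> carrier_vec k" and y: "y \<in> carrier_vec n"
  shows "(A *\<^sub>v x) \<bullet> y = x \<bullet> (transpose_mat A *\<^sub>v y)"
proof -
  have "(A *\<^sub>v x) \<bullet> y = y \<bullet> (A *\<^sub>v x)" using A x y by (intro comm_scalar_prod) auto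
  also have "\<dots> = (transpose_mat A *\<^sub>v y) \<bullet> x" using transpose_vec_mult_scalar[OF A x y] ..
  also have "\<dots> = x \<bullet> (transpose_mat A *\<^sub>v y)" using A x y by (intro comm_scalar_prod) auto
  finally show ?thesis .
qed

lemma map_mat_cnj_cnj[simp]: "map_mat cnj (map_mat cnj (A :: complex mat)) = A"
  by (intro eq_matI) auto

lemma map_mat_cnj_mult:
  fixes A B :: "complex mat"
  assumes "A \<in> carrier_mat n k" and "B \<in> carrier_mat k l"
  shows "map_mat cnj (A * B) = map_mat cnj A * map_mat cnj B"
  using assms by (intro eq_matI) (auto simp: scalar_prod_def)

lemma map_mat_cnj_mult_vec:
  fixes A :: "complex mat"
  assumes "A \<in> carrier_mat n k" and "x \<in> carrier_vec k"
  shows "map_mat cnj A *\<^sub>v conjugate x = conjugate (A *\<^sub>v x)"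
  using assms by (intro eq_vecI) (auto simp: scalar_prod_def)

lemma cscalar_prod_mult_mat_vec:
  fixes A :: "complex mat"
  assumes A: "A \<in> carrier_mat n k" and u: "u \<in> carrier_vec n" and v: "v \<in> carrier_vec k"
  shows "u \<bullet>c (A *\<^sub>v v) = (ctrans A *\<^sub>v u) \<bullet>c v"
proof -
  have "ctrans A = transpose_mat (map_mat cnj A)" unfolding ctrans_def by (intro eq_matI) auto
  moreover have "u \<bullet>c (A *\<^sub>v v) = u \<bullet> (map_mat cnj A *\<^sub>v conjugate v)"
    using map_mat_cnj_mult_vec[OF A v] by simp
  moreover have "\<dots> = (transpose_mat (map_mat cnj A) *\<^sub>v u) \<bullet> conjugate v"
    using A u v by (intro transpose_vec_mult_scalar[symmetric]) auto
  ultimately show ?thesis by simp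
qed

lemma transpose_mult_eq_one_swap:
  fixes A B :: "'a::comm_semiring_1 mat"
  assumes "A \<in> carrier_mat n n" and "B \<in> carrier_mat n n" and "transpose_mat B * A = 1\<^sub>m n"
  shows "transpose_mat A * B = 1\<^sub>m n"
  using arg_cong[OF assms(3), of transpose_mat] assms(1,2) by (simp add: transpose_mult[of _ n n])

lemma bij_betw_mult_mat_vec:
  fixes A B :: "'a::field mat"
  assumes A: "A \<in> carrier_mat n n" and B: "B \<in> carrier_mat n n" and BA: "B * A = 1\<^sub>m n"
  shows "bij_betw ((*\<^sub>v) A) (carrier_vec n) (carrier_vec n)"
proof (rule bij_betw_byWitness[where f' = "(*\<^sub>v) B"])
  have AB: "A * B = 1\<^sub>m n" using mat_mult_left_right_inverse[OF B A BA] .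
  show "\<forall>x\<in>carrier_vec n. B *\<^sub>v (A *\<^sub>v x) = x" "\<forall>x\<in>carrier_vec n. A *\<^sub>v (B *\<^sub>v x) = x"
    using A B AB BA by (auto simp flip: assoc_mult_mat_vec)
qed (use A B in auto)

lemma bij_betw_mult_mat:
  fixes A B :: "'a::field mat"
  assumes A: "A \<in> carrier_mat n n" and B: "B \<in> carrier_mat n n" and BA: "B * A = 1\<^sub>m n"
    and S: "S \<subseteq> carrier_mat n k" and AS: "(*) A ` S \<subseteq> S" and BS: "(*) B ` S \<subseteq> S"
  shows "bij_betw ((*) A) S S"
proof (rule bij_betw_byWitness[where f' = "(*) B"])
  have AB: "A * B = 1\<^sub>m n" using mat_mult_left_right_inverse[OF B A BA] .
  show "\<forall>X\<in>S. B * (A * X) = X" "\<forall>X\<in>S. A * (B * X) = X"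
    using A B AB BA S by (auto simp flip: assoc_mult_mat)
qed (use AS BS in auto)

lemma clinear_on_mult_mat:
  assumes "M \<in> carrier_mat m m" and "S \<subseteq> carrier_mat m n"
  shows "clinear_on S ((*) M) (+) (\<cdot>\<^sub>m) (+) (\<cdot>\<^sub>m)"
  using assms unfolding clinear_on_def
  by (auto intro!: mult_add_distrib_mat mult_smult_distrib simp: subset_iff)

lemma clinear_on_pair_partial:
  fixes \<Phi> :: "complex vec \<times> complex vec \<Rightarrow> complex vec \<times> complex vec"
  assumes linear: "clinear_on (carrier_vec n \<times> carrier_vec n) \<Phi> vpair_add vpair_smult vpair_add vpair_smult"
    and v: "v \<in> carrier_vec n" and w: "w \<in> carrier_vec n"
  shows "\<Phi> (v + w, 0\<^sub>v n) = vpair_add (\<Phi> (v, 0\<^sub>v n)) (\<Phi> (w, 0\<^sub>v n))"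
    and "\<Phi> (0\<^sub>v n, v + w) = vpair_add (\<Phi> (0\<^sub>v n, v)) (\<Phi> (0\<^sub>v n, w))"
    and "\<Phi> (c \<cdot>\<^sub>v v, 0\<^sub>v n) = vpair_smult c (\<Phi> (v, 0\<^sub>v n))"
    and "\<Phi> (0\<^sub>v n, c \<cdot>\<^sub>v v) = vpair_smult c (\<Phi> (0\<^sub>v n, v))"
    and "\<Phi> (v, w) = vpair_add (\<Phi> (v, 0\<^sub>v n)) (\<Phi> (0\<^sub>v n, w))"
proof -
  have add: "\<Phi> (vpair_add x y) = vpair_add (\<Phi> x) (\<Phi> y)"
    if "x \<in> carrier_vec n \<times> carrier_vec n" "y \<in> carrier_vec n \<times> carrier_vec n" for x y
    using linear that unfolding clinear_on_def by blast
  have smult: "\<Phi> (vpair_smult c x) = vpair_smult c (\<Phi> x)" if "x \<in> carrier_vec n \<times> carrier_vec n" for c x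
    using linear that unfolding clinear_on_def by blast
  have zero: "0\<^sub>v n + 0\<^sub>v n = (0\<^sub>v n :: complex vec)" "c \<cdot>\<^sub>v 0\<^sub>v n = (0\<^sub>v n :: complex vec)" by (auto intro!: eq_vecI)
  show "\<Phi> (v + w, 0\<^sub>v n) = vpair_add (\<Phi> (v, 0\<^sub>v n)) (\<Phi> (w, 0\<^sub>v n))"
    "\<Phi> (0\<^sub>v n, v + w) = vpair_add (\<Phi> (0\<^sub>v n, v)) (\<Phi> (0\<^sub>v n, w))"
    using add[of "(v, 0\<^sub>v n)" "(w, 0\<^sub>v n)"] add[of "(0\<^sub>v n, v)" "(0\<^sub>v n, w)"] v w zero
    by (simp_all add: vpair_add_def)
  show "\<Phi> (c \<cdot>\<^sub>v v, 0\<^sub>v n) = vpair_smult c (\<Phi> (v, 0\<^sub>v n))"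
    "\<Phi> (0\<^sub>v n, c \<cdot>\<^sub>v v) = vpair_smult c (\<Phi> (0\<^sub>v n, v))"
    using smult[of "(v, 0\<^sub>v n)" c] smult[of "(0\<^sub>v n, v)" c] v zero
    by (simp_all add: vpair_smult_def)
  show "\<Phi> (v, w) = vpair_add (\<Phi> (v, 0\<^sub>v n)) (\<Phi> (0\<^sub>v n, w))"
    using add[of "(v, 0\<^sub>v n)" "(0\<^sub>v n, w)"] v w by (simp add: vpair_add_def)
qed

lemma csubspace_of_mat_eq:
  fixes A B :: "complex mat"
  assumes A: "A \<in> carrier_mat k n" and B: "B \<in> carrier_mat k n"
  shows "csubspace_of n {x \<in> carrier_vec n. A *\<^sub>v x = B *\<^sub>v x}"
  unfolding csubspace_of_def
proof (intro conjI ballI allI)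
  show "0\<^sub>v n \<in> {x \<in> carrier_vec n. A *\<^sub>v x = B *\<^sub>v x}"
    using mult_mat_vec_zero[OF A] mult_mat_vec_zero[OF B] by simp
next
  fix x y assume "x \<in> {x \<in> carrier_vec n. A *\<^sub>v x = B *\<^sub>v x}" "y \<in> {x \<in> carrier_vec n. A *\<^sub>v x = B *\<^sub>v x}"
  with A B show "x + y \<in> {x \<in> carrier_vec n. A *\<^sub>v x = B *\<^sub>v x}"
    by (simp add: mult_add_distrib_mat_vec[OF A] mult_add_distrib_mat_vec[OF B])
next
  fix c x assume "x \<in> {x \<in> carrier_vec n. A *\<^sub>v x = B *\<^sub>v x}"
  with A B show "c \<cdot>\<^sub>v x \<in> {x \<in> carrier_vec n. A *\<^sub>v x = B *\<^sub>v x}"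
    by (simp add: mult_mat_vec[OF A] mult_mat_vec[OF B])
qed auto

lemma csubspace_of_orthogonal:
  assumes S: "S \<subseteq> carrier_vec n"
  shows "csubspace_of n {w \<in> carrier_vec n. \<forall>u\<in>S. u \<bullet>c w = 0}"
  unfolding csubspace_of_def
proof (intro conjI ballI allI)
  fix a b assume a: "a \<in> {w \<in> carrier_vec n. \<forall>u\<in>S. u \<bullet>c w = 0}"
    and b: "b \<in> {w \<in> carrier_vec n. \<forall>u\<in>S. u \<bullet>c w = 0}"
  have "u \<bullet>c (a + b) = u \<bullet>c a + u \<bullet>c b" if "u \<in> S" for u
    using a b that S by (auto simp: conjugate_add_vec[of _ n] scalar_prod_add_distrib[of _ n])
  with a b show "a + b \<in> {w \<in> carrier_vec n. \<forall>u\<in>S. u \<bullet>c w = 0}" by simp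
next
  fix c a assume a: "a \<in> {w \<in> carrier_vec n. \<forall>u\<in>S. u \<bullet>c w = 0}"
  have "u \<bullet>c (c \<cdot>\<^sub>v a) = cnj c * (u \<bullet>c a)" if "u \<in> S" for u
    using a that S by (auto simp: conjugate_smult_vec)
  with a show "c \<cdot>\<^sub>v a \<in> {w \<in> carrier_vec n. \<forall>u\<in>S. u \<bullet>c w = 0}" by simp
qed (use S in auto)

section \<open>Intertwiners\<close>

lemma hom_spaceI:
  "A \<in> carrier_mat k n \<Longrightarrow> (\<And>g. g \<in> carrier G \<Longrightarrow> A * \<tau> g = \<upsilon> g * A) \<Longrightarrow> A \<in> hom_space G n \<tau> k \<upsilon>"
  unfolding hom_space_def by blast

lemma hom_spaceD:
  assumes "A \<in> hom_space G n \<tau> k \<upsilon>"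
  shows "A \<in> carrier_mat k n" and "g \<in> carrier G \<Longrightarrow> A * \<tau> g = \<upsilon> g * A"
  using assms unfolding hom_space_def by auto

lemma hom_space_mult_vec:
  assumes A: "A \<in> hom_space G n \<tau> k \<upsilon>" and \<tau>: "\<tau> ` carrier G \<subseteq> carrier_mat n n"
    and \<upsilon>: "\<upsilon> ` carrier G \<subseteq> carrier_mat k k" and g: "g \<in> carrier G" and x: "x \<in> carrier_vec n"
  shows "A *\<^sub>v (\<tau> g *\<^sub>v x) = \<upsilon> g *\<^sub>v (A *\<^sub>v x)"
proof -
  have "A *\<^sub>v (\<tau> g *\<^sub>v x) = (A * \<tau> g) *\<^sub>v x" using hom_spaceD(1)[OF A] \<tau> g x by auto
  also have "\<dots> = (\<upsilon> g * A) *\<^sub>v x" using hom_spaceD(2)[OF A g] by simp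
  also have "\<dots> = \<upsilon> g *\<^sub>v (A *\<^sub>v x)" using hom_spaceD(1)[OF A] \<upsilon> g x by auto
  finally show ?thesis .
qed

lemma hom_spaceI_mult_vec:
  assumes A: "A \<in> carrier_mat k n"
    and \<tau>: "\<tau> ` carrier G \<subseteq> carrier_mat n n" and \<upsilon>: "\<upsilon> ` carrier G \<subseteq> carrier_mat k k"
    and equivariant: "\<And>g x. g \<in> carrier G \<Longrightarrow> x \<in> carrier_vec n \<Longrightarrow> A *\<^sub>v (\<tau> g *\<^sub>v x) = \<upsilon> g *\<^sub>v (A *\<^sub>v x)"
  shows "A \<in> hom_space G n \<tau> k \<upsilon>"
proof (rule hom_spaceI[OF A])
  fix g assume g: "g \<in> carrier G"
  then have \<tau>g: "\<tau> g \<in> carrier_mat n n" and \<upsilon>g: "\<upsilon> g \<in> carrier_mat k k" using \<tau> \<upsilon> by auto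
  show "A * \<tau> g = \<upsilon> g * A"
    by (rule eq_mat_by_mult_vecI) (use A \<tau>g \<upsilon>g equivariant[OF g] in auto)
qed

lemma equivariant_linear_map_is_hom:
  assumes \<tau>: "\<tau> ` carrier G \<subseteq> carrier_mat n n" and \<upsilon>: "\<upsilon> ` carrier G \<subseteq> carrier_mat k k"
    and carrier: "\<And>x. x \<in> carrier_vec n \<Longrightarrow> f x \<in> carrier_vec k"
    and add: "\<And>x y. x \<in> carrier_vec n \<Longrightarrow> y \<in> carrier_vec n \<Longrightarrow> f (x + y) = f x + f y"
    and smult: "\<And>c x. x \<in> carrier_vec n \<Longrightarrow> f (c \<cdot>\<^sub>v x) = c \<cdot>\<^sub>v f x"
    and equivariant: "\<And>g x. g \<in> carrier G \<Longrightarrow> x \<in> carrier_vec n \<Longrightarrow> f (\<tau> g *\<^sub>v x) = \<upsilon> g *\<^sub>v f x"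
  shows "\<exists>M\<in>hom_space G n \<tau> k \<upsilon>. \<forall>x\<in>carrier_vec n. f x = M *\<^sub>v x"
proof -
  obtain M where M: "M \<in> carrier_mat k n" and f: "\<And>x. x \<in> carrier_vec n \<Longrightarrow> f x = M *\<^sub>v x"
    using linear_map_is_mult_mat_vec[OF carrier add smult] by blast
  have "M \<in> hom_space G n \<tau> k \<upsilon>"
  proof (rule hom_spaceI_mult_vec[OF M \<tau> \<upsilon>])
    fix g and x :: "complex vec" assume g: "g \<in> carrier G" and x: "x \<in> carrier_vec n"
    then have "\<tau> g *\<^sub>v x \<in> carrier_vec n" using \<tau> by auto
    then show "M *\<^sub>v (\<tau> g *\<^sub>v x) = \<upsilon> g *\<^sub>v (M *\<^sub>v x)" using f x equivariant[OF g x] by simp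
  qed
  with f show ?thesis by blast
qed

lemma zero_mem_hom_space:
  assumes "\<tau> ` carrier G \<subseteq> carrier_mat n n" and "\<upsilon> ` carrier G \<subseteq> carrier_mat k k"
  shows "0\<^sub>m k n \<in> hom_space G n \<tau> k \<upsilon>"
proof (rule hom_spaceI)
  fix g assume "g \<in> carrier G"
  with assms have "\<tau> g \<in> carrier_mat n n" "\<upsilon> g \<in> carrier_mat k k" by auto
  then show "0\<^sub>m k n * \<tau> g = \<upsilon> g * 0\<^sub>m k n" by simp
qed simp

lemma one_mem_hom_space:
  assumes "\<tau> ` carrier G \<subseteq> carrier_mat n n"
  shows "1\<^sub>m n \<in> hom_space G n \<tau> n \<tau>"
  using assms by (intro hom_spaceI) (auto simp: image_subset_iff)

lemma mult_mem_hom_space: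
  assumes \<tau>: "\<tau> ` carrier G \<subseteq> carrier_mat n n" and \<upsilon>: "\<upsilon> ` carrier G \<subseteq> carrier_mat k k"
    and \<nu>: "\<nu> ` carrier G \<subseteq> carrier_mat l l"
    and A: "A \<in> hom_space G n \<tau> k \<upsilon>" and B: "B \<in> hom_space G k \<upsilon> l \<nu>"
  shows "B * A \<in> hom_space G n \<tau> l \<nu>"
proof (rule hom_spaceI)
  have Ac: "A \<in> carrier_mat k n" and Bc: "B \<in> carrier_mat l k" using A B by (auto dest: hom_spaceD)
  then show "B * A \<in> carrier_mat l n" by simp
  fix g assume g: "g \<in> carrier G"
  then have \<tau>g: "\<tau> g \<in> carrier_mat n n" and \<upsilon>g: "\<upsilon> g \<in> carrier_mat k k"
    and \<nu>g: "\<nu> g \<in> carrier_mat l l"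
    using \<tau> \<upsilon> \<nu> by auto
  have "B * A * \<tau> g = B * (\<upsilon> g * A)"
    using assoc_mult_mat[OF Bc Ac \<tau>g] hom_spaceD(2)[OF A g] by simp
  also have "\<dots> = \<nu> g * B * A"
    using assoc_mult_mat[OF Bc \<upsilon>g Ac] hom_spaceD(2)[OF B g] by simp
  also have "\<dots> = \<nu> g * (B * A)" using assoc_mult_mat[OF \<nu>g Bc Ac] .
  finally show "B * A * \<tau> g = \<nu> g * (B * A)" .
qed

lemma add_mem_hom_space:
  assumes \<tau>: "\<tau> ` carrier G \<subseteq> carrier_mat n n" and \<upsilon>: "\<upsilon> ` carrier G \<subseteq> carrier_mat k k"
    and A: "A \<in> hom_space G n \<tau> k \<upsilon>" and B: "B \<in> hom_space G n \<tau> k \<upsilon>"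
  shows "A + B \<in> hom_space G n \<tau> k \<upsilon>"
proof (rule hom_spaceI)
  have Ac: "A \<in> carrier_mat k n" and Bc: "B \<in> carrier_mat k n" using A B by (auto dest: hom_spaceD)
  then show "A + B \<in> carrier_mat k n" by simp
  fix g assume g: "g \<in> carrier G"
  then have \<tau>g: "\<tau> g \<in> carrier_mat n n" and \<upsilon>g: "\<upsilon> g \<in> carrier_mat k k" using \<tau> \<upsilon> by auto
  show "(A + B) * \<tau> g = \<upsilon> g * (A + B)"
    using hom_spaceD(2)[OF A g] hom_spaceD(2)[OF B g]
    by (simp add: add_mult_distrib_mat[OF Ac Bc \<tau>g] mult_add_distrib_mat[OF \<upsilon>g Ac Bc])
qed

lemma diff_mem_hom_space:
  assumes \<tau>: "\<tau> ` carrier G \<subseteq> carrier_mat n n" and \<upsilon>: "\<upsilon> ` carrier G \<subseteq> carrier_mat k k"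
    and A: "A \<in> hom_space G n \<tau> k \<upsilon>" and B: "B \<in> hom_space G n \<tau> k \<upsilon>"
  shows "A - B \<in> hom_space G n \<tau> k \<upsilon>"
proof (rule hom_spaceI)
  have Ac: "A \<in> carrier_mat k n" and Bc: "B \<in> carrier_mat k n" using A B by (auto dest: hom_spaceD)
  then show "A - B \<in> carrier_mat k n" by (simp add: minus_carrier_mat)
  fix g assume g: "g \<in> carrier G"
  then have \<tau>g: "\<tau> g \<in> carrier_mat n n" and \<upsilon>g: "\<upsilon> g \<in> carrier_mat k k" using \<tau> \<upsilon> by auto
  show "(A - B) * \<tau> g = \<upsilon> g * (A - B)"
    using hom_spaceD(2)[OF A g] hom_spaceD(2)[OF B g]
    by (simp add: minus_mult_distrib_mat[OF Ac Bc \<tau>g] mult_minus_distrib_mat[OF \<upsilon>g Ac Bc])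
qed

lemma dual_rep_carrier:
  assumes "group G" and "\<tau> ` carrier G \<subseteq> carrier_mat n n"
  shows "dual_rep G \<tau> ` carrier G \<subseteq> carrier_mat n n"
  using assms by (auto simp: dual_rep_def image_subset_iff)

lemma dual_dual_rep:
  assumes "group G" and "g \<in> carrier G"
  shows "dual_rep G (dual_rep G \<tau>) g = \<tau> g"
  using assms by (simp add: dual_rep_def group.inv_closed group.inv_inv)

lemma hom_space_dual_dual:
  assumes "group G"
  shows "hom_space G n (dual_rep G (dual_rep G \<tau>)) k (dual_rep G (dual_rep G \<upsilon>)) = hom_space G n \<tau> k \<upsilon>"
  unfolding hom_space_def using dual_dual_rep[OF assms] by simp

lemma transpose_mem_hom_space_dual:
  assumes G: "group G" and \<tau>: "\<tau> ` carrier G \<subseteq> carrier_mat n n" and \<upsilon>: "\<upsilon> ` carrier G \<subseteq> carrier_mat k k"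
    and A: "A \<in> hom_space G n \<tau> k \<upsilon>"
  shows "transpose_mat A \<in> hom_space G k (dual_rep G \<upsilon>) n (dual_rep G \<tau>)"
proof (rule hom_spaceI)
  have Ac: "A \<in> carrier_mat k n" using A by (rule hom_spaceD)
  then show "transpose_mat A \<in> carrier_mat n k" by simp
  fix g assume "g \<in> carrier G"
  then have g': "inv\<^bsub>G\<^esub> g \<in> carrier G" using G by (simp add: group.inv_closed)
  have \<tau>g: "\<tau> (inv\<^bsub>G\<^esub> g) \<in> carrier_mat n n" and \<upsilon>g: "\<upsilon> (inv\<^bsub>G\<^esub> g) \<in> carrier_mat k k"
    using \<tau> \<upsilon> g' by auto
  have "transpose_mat (A * \<tau> (inv\<^bsub>G\<^esub> g)) = transpose_mat (\<upsilon> (inv\<^bsub>G\<^esub> g) * A)"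
    using hom_spaceD(2)[OF A g'] by simp
  then show "transpose_mat A * dual_rep G \<upsilon> g = dual_rep G \<tau> g * transpose_mat A"
    unfolding dual_rep_def transpose_mult[OF Ac \<tau>g] transpose_mult[OF \<upsilon>g Ac] by simp
qed

lemma cnj_mem_hom_space:
  fixes A :: "complex mat"
  assumes \<tau>: "\<tau> ` carrier G \<subseteq> carrier_mat n n" and \<upsilon>: "\<upsilon> ` carrier G \<subseteq> carrier_mat k k"
    and \<tau>': "\<And>g. g \<in> carrier G \<Longrightarrow> \<tau>' g = map_mat cnj (\<tau> g)"
    and \<upsilon>': "\<And>g. g \<in> carrier G \<Longrightarrow> \<upsilon>' g = map_mat cnj (\<upsilon> g)"
    and A: "A \<in> hom_space G n \<tau> k \<upsilon>"
  shows "map_mat cnj A \<in> hom_space G n \<tau>' k \<upsilon>'"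
proof (rule hom_spaceI)
  have Ac: "A \<in> carrier_mat k n" using A by (rule hom_spaceD)
  then show "map_mat cnj A \<in> carrier_mat k n" by simp
  fix g assume g: "g \<in> carrier G"
  then have \<tau>g: "\<tau> g \<in> carrier_mat n n" and \<upsilon>g: "\<upsilon> g \<in> carrier_mat k k" using \<tau> \<upsilon> by auto
  show "map_mat cnj A * \<tau>' g = \<upsilon>' g * map_mat cnj A"
    using hom_spaceD(2)[OF A g] map_mat_cnj_mult[OF Ac \<tau>g] map_mat_cnj_mult[OF \<upsilon>g Ac] \<tau>'[OF g] \<upsilon>'[OF g]
    by simp
qed

lemma unitary_rep_carrier: "unitary_rep G T n \<tau> \<Longrightarrow> \<tau> ` carrier G \<subseteq> carrier_mat n n"
  unfolding unitary_rep_def unitary_mat_def by blast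

lemma unitary_rep_inv:
  assumes G: "group G" and \<tau>: "unitary_rep G T n \<tau>" and g: "g \<in> carrier G"
  shows "\<tau> (inv\<^bsub>G\<^esub> g) = ctrans (\<tau> g)"
proof -
  have g': "inv\<^bsub>G\<^esub> g \<in> carrier G" using G g by (simp add: group.inv_closed)
  have \<tau>g: "\<tau> g \<in> carrier_mat n n" and \<tau>g': "\<tau> (inv\<^bsub>G\<^esub> g) \<in> carrier_mat n n"
    using unitary_rep_carrier[OF \<tau>] g g' by auto
  have c: "ctrans (\<tau> g) \<in> carrier_mat n n" using \<tau>g unfolding ctrans_def by simp
  have "\<tau> g * ctrans (\<tau> g) = 1\<^sub>m n" using \<tau> g unfolding unitary_rep_def unitary_mat_def by blast
  then have left_inv: "ctrans (\<tau> g) * \<tau> g = 1\<^sub>m n" by (rule mat_mult_left_right_inverse[OF \<tau>g c])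
  have "\<tau> g * \<tau> (inv\<^bsub>G\<^esub> g) = \<tau> (g \<otimes>\<^bsub>G\<^esub> inv\<^bsub>G\<^esub> g)"
    using \<tau> g g' unfolding unitary_rep_def by simp
  also have "\<dots> = 1\<^sub>m n" using \<tau> G g unfolding unitary_rep_def by (simp add: group.r_inv)
  finally have "ctrans (\<tau> g) * (\<tau> g * \<tau> (inv\<^bsub>G\<^esub> g)) = ctrans (\<tau> g)" using c by simp
  then have "(ctrans (\<tau> g) * \<tau> g) * \<tau> (inv\<^bsub>G\<^esub> g) = ctrans (\<tau> g)"
    using c \<tau>g \<tau>g' by (simp add: assoc_mult_mat[of _ n n _ n _ n])
  with left_inv \<tau>g' show ?thesis by simp
qed

lemma dual_rep_unitary:
  assumes "group G" and "unitary_rep G T n \<tau>" and "g \<in> carrier G"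
  shows "dual_rep G \<tau> g = map_mat cnj (\<tau> g)"
  unfolding dual_rep_def unitary_rep_inv[OF assms] ctrans_def by (intro eq_matI) auto

lemma hom_space_kernel_trivial:
  assumes irr: "irreducible_rep G n \<tau>"
    and \<tau>: "\<tau> ` carrier G \<subseteq> carrier_mat n n" and \<upsilon>: "\<upsilon> ` carrier G \<subseteq> carrier_mat k k"
    and M: "M \<in> hom_space G n \<tau> k \<upsilon>" and nonzero: "M \<noteq> 0\<^sub>m k n"
  shows "{x \<in> carrier_vec n. M *\<^sub>v x = 0\<^sub>v k} = {0\<^sub>v n}"
proof -
  have Mc: "M \<in> carrier_mat k n" using M by (rule hom_spaceD)
  define K where "K = {x \<in> carrier_vec n. M *\<^sub>v x = 0\<^sub>v k}"
  have K_eq: "K = {x \<in> carrier_vec n. M *\<^sub>v x = 0\<^sub>m k n *\<^sub>v x}"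
    unfolding K_def by (auto simp: zero_mat_mult_vec)
  then have "csubspace_of n K" using csubspace_of_mat_eq[OF Mc zero_carrier_mat] by simp
  moreover have "\<tau> g *\<^sub>v x \<in> K" if g: "g \<in> carrier G" and x: "x \<in> K" for g x
  proof -
    have "\<upsilon> g \<in> carrier_mat k k" "\<tau> g \<in> carrier_mat n n" using \<tau> \<upsilon> g by auto
    then show ?thesis using x hom_space_mult_vec[OF M \<tau> \<upsilon> g] by (auto simp: K_def)
  qed
  ultimately have "invariant_subspace G n \<tau> K" unfolding invariant_subspace_def by blast
  moreover have "K \<noteq> carrier_vec n"
  proof
    assume "K = carrier_vec n"
    then have "M = 0\<^sub>m k n" using Mc K_eq by (intro eq_mat_by_mult_vecI) auto
    with nonzero show False ..
  qed
  ultimately show ?thesis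
    using irr unfolding irreducible_rep_def irreducible_subrep_def K_def by auto
qed

lemma hom_space_eq_zero_if_not_iso:
  assumes irr: "irreducible_rep G n \<tau>"
    and \<tau>: "\<tau> ` carrier G \<subseteq> carrier_mat n n" and \<upsilon>: "\<upsilon> ` carrier G \<subseteq> carrier_mat n n"
    and M: "M \<in> hom_space G n \<tau> n \<upsilon>" and not_iso: "\<not> rep_iso_to G n \<tau> n \<upsilon> (carrier_vec n)"
  shows "M = 0\<^sub>m n n"
proof (rule ccontr)
  assume "M \<noteq> 0\<^sub>m n n"
  have Mc: "M \<in> carrier_mat n n" using M by (rule hom_spaceD)
  have "det M \<noteq> 0"
    using hom_space_kernel_trivial[OF irr \<tau> \<upsilon> M \<open>M \<noteq> 0\<^sub>m n n\<close>] Mc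
    by (auto simp: det_0_iff_vec_prod_zero)
  then have "M \<in> Units (ring_mat TYPE(complex) n undefined)" by (rule det_non_zero_imp_unit[OF Mc])
  then obtain M' where M': "M' \<in> carrier_mat n n" "M' * M = 1\<^sub>m n"
    unfolding Units_def by (auto simp: ring_mat_simps)
  have "rep_iso_to G n \<tau> n \<upsilon> (carrier_vec n)"
    unfolding rep_iso_to_def
  proof (intro exI[of _ "(*\<^sub>v) M"] conjI ballI allI)
    show "bij_betw ((*\<^sub>v) M) (carrier_vec n) (carrier_vec n)" using bij_betw_mult_mat_vec[OF Mc M'] .
    show "M *\<^sub>v (x + y) = M *\<^sub>v x + M *\<^sub>v y" if "x \<in> carrier_vec n" "y \<in> carrier_vec n" for x y
      using Mc that by (rule mult_add_distrib_mat_vec)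
    show "M *\<^sub>v (c \<cdot>\<^sub>v x) = c \<cdot>\<^sub>v (M *\<^sub>v x)" if "x \<in> carrier_vec n" for c x
      using Mc that by (rule mult_mat_vec)
    show "M *\<^sub>v (\<tau> g *\<^sub>v x) = \<upsilon> g *\<^sub>v (M *\<^sub>v x)" if "g \<in> carrier G" "x \<in> carrier_vec n" for g x
      using hom_space_mult_vec[OF M \<tau> \<upsilon>] that .
  qed
  with not_iso show False ..
qed

section \<open>Irreducible subrepresentations and orthogonal complements\<close>

definition lin_indpt_vecs :: "nat \<Rightarrow> complex vec set \<Rightarrow> bool" where
  "lin_indpt_vecs n S \<longleftrightarrow> S \<subseteq> carrier_vec n \<and> \<not> module.lin_dep class_ring (module_vec TYPE(complex) n) S"

definition subspace_dim :: "nat \<Rightarrow> complex vec set \<Rightarrow> nat" where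
  "subspace_dim n U = Max (card ` {S. S \<subseteq> U \<and> lin_indpt_vecs n S})"

lemma lin_indpt_vecs_card:
  assumes "lin_indpt_vecs n S"
  shows "finite S" and "card S \<le> n"
proof -
  interpret V: vec_space "TYPE(complex)" n .
  have "S \<subseteq> carrier_vec n" "\<not> V.lin_dep S" using assms unfolding lin_indpt_vecs_def by auto
  then show "finite S" "card S \<le> n" using V.li_le_dim[OF V.fin_dim] V.dim_is_n by auto
qed

lemma
  shows subspace_dim_attained: "\<exists>S\<subseteq>U. lin_indpt_vecs n S \<and> card S = subspace_dim n U"
    and card_le_subspace_dim: "S \<subseteq> U \<Longrightarrow> lin_indpt_vecs n S \<Longrightarrow> card S \<le> subspace_dim n U"
proof -
  interpret V: vec_space "TYPE(complex)" n .
  let ?C = "card ` {S. S \<subseteq> U \<and> lin_indpt_vecs n S}"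
  have fin: "finite ?C" by (rule finite_subset[of _ "{..n}"]) (auto dest: lin_indpt_vecs_card)
  have "lin_indpt_vecs n {}" unfolding lin_indpt_vecs_def V.lin_dep_def by auto
  then have "?C \<noteq> {}" by blast
  with fin show "\<exists>S\<subseteq>U. lin_indpt_vecs n S \<and> card S = subspace_dim n U"
    unfolding subspace_dim_def using Max_in by fastforce
  show "S \<subseteq> U \<Longrightarrow> lin_indpt_vecs n S \<Longrightarrow> card S \<le> subspace_dim n U"
    unfolding subspace_dim_def using fin by (intro Max_ge) auto
qed

lemma maximal_lin_indpt_vecs_span:
  assumes U: "csubspace_of n U" and S: "S \<subseteq> U" "lin_indpt_vecs n S" "card S = subspace_dim n U"
  shows "module.span class_ring (module_vec TYPE(complex) n) S = U"
proof -
  interpret V: vec_space "TYPE(complex)" n .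
  have Uc: "U \<subseteq> carrier_vec n" and Sc: "S \<subseteq> carrier_vec n" "\<not> V.lin_dep S" and fin: "finite S"
    using U S lin_indpt_vecs_card(1)[OF S(2)] unfolding csubspace_of_def lin_indpt_vecs_def by auto
  have "LinearCombinations.submodule class_ring U V.V"
    using U V.module_axioms unfolding csubspace_of_def by (intro LinearCombinations.submodule.intro) auto
  then have "V.span S \<subseteq> U" using V.span_is_subset[OF S(1)] by blast
  moreover have "v \<in> V.span S" if v: "v \<in> U" for v
  proof (rule ccontr)
    assume v_notin: "v \<notin> V.span S"
    then have "v \<notin> S" using V.in_own_span[OF Sc(1)] by auto
    moreover have "\<not> V.lin_dep (insert v S)"
      using V.lin_dep_iff_in_span[of S v] Sc v_notin v Uc \<open>v \<notin> S\<close> by auto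
    ultimately have "card (insert v S) \<le> subspace_dim n U"
      using card_le_subspace_dim[of "insert v S" U n] S v Uc Sc unfolding lin_indpt_vecs_def by auto
    with S(3) fin \<open>v \<notin> S\<close> show False by simp
  qed
  ultimately show ?thesis by blast
qed

lemma subspace_dim_less:
  assumes U: "csubspace_of n U" and U': "csubspace_of n U'" and sub: "U' \<subset> U"
  shows "subspace_dim n U' < subspace_dim n U"
proof -
  interpret V: vec_space "TYPE(complex)" n .
  obtain S where S: "S \<subseteq> U'" "lin_indpt_vecs n S" "card S = subspace_dim n U'"
    using subspace_dim_attained by blast
  have span: "V.span S = U'" by (rule maximal_lin_indpt_vecs_span[OF U' S])
  obtain u where u: "u \<in> U" "u \<notin> U'" using sub by auto
  have Sc: "S \<subseteq> carrier_vec n" "\<not> V.lin_dep S" and fin: "finite S"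
    using S lin_indpt_vecs_card(1)[OF S(2)] unfolding lin_indpt_vecs_def by auto
  have uc: "u \<in> carrier_vec n" using u U unfolding csubspace_of_def by auto
  have "u \<notin> S" using u S by auto
  moreover have "\<not> V.lin_dep (insert u S)"
    using V.lin_dep_iff_in_span[of S u] Sc span u uc \<open>u \<notin> S\<close> by auto
  ultimately have "card (insert u S) \<le> subspace_dim n U"
    using card_le_subspace_dim[of "insert u S" U n] S u sub uc Sc unfolding lin_indpt_vecs_def by auto
  with S(3) fin \<open>u \<notin> S\<close> show ?thesis by simp
qed

lemma exists_irreducible_subrep:
  assumes inv: "invariant_subspace G n \<tau> U" and nonzero: "U \<noteq> {0\<^sub>v n}"
  obtains W where "W \<subseteq> U" and "irreducible_subrep G n \<tau> W"
proof -
  let ?P = "\<lambda>W. invariant_subspace G n \<tau> W \<and> W \<noteq> {0\<^sub>v n} \<and> W \<subseteq> U"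
  obtain W where W: "?P W" and min: "\<And>W'. ?P W' \<Longrightarrow> subspace_dim n W \<le> subspace_dim n W'"
    using ex_has_least_nat[of ?P U "subspace_dim n"] inv nonzero by blast
  have "irreducible_subrep G n \<tau> W"
    unfolding irreducible_subrep_def
  proof (intro conjI allI impI)
    show "invariant_subspace G n \<tau> W" "W \<noteq> {0\<^sub>v n}" using W by auto
    fix W' assume W': "invariant_subspace G n \<tau> W' \<and> W' \<subseteq> W"
    show "W' = {0\<^sub>v n} \<or> W' = W"
    proof (rule ccontr)
      assume "\<not> (W' = {0\<^sub>v n} \<or> W' = W)"
      then have "?P W'" and "W' \<subset> W" using W' W by auto
      then have "subspace_dim n W \<le> subspace_dim n W'" and "subspace_dim n W' < subspace_dim n W"
        using min subspace_dim_less W W' unfolding invariant_subspace_def by auto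
      then show False by simp
    qed
  qed
  with W that show thesis by blast
qed

lemma exists_orthogonal_vec:
  assumes U: "csubspace_of n U" and proper: "U \<noteq> carrier_vec n"
  obtains w where "w \<in> carrier_vec n" "w \<noteq> 0\<^sub>v n" "\<And>u. u \<in> U \<Longrightarrow> u \<bullet>c w = 0"
proof -
  interpret V: cof_vec_space n "TYPE(complex)" .
  have Uc: "U \<subseteq> carrier_vec n" using U unfolding csubspace_of_def by auto
  obtain S where S: "S \<subseteq> U" "lin_indpt_vecs n S" "card S = subspace_dim n U"
    using subspace_dim_attained by blast
  have Sc: "S \<subseteq> carrier_vec n" "\<not> V.lin_dep S" and fin: "finite S"
    using S lin_indpt_vecs_card(1)[OF S(2)] unfolding lin_indpt_vecs_def by auto
  obtain ws where ws: "set ws = S" "distinct ws" using finite_distinct_list[OF fin] by blast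
  define us where "us = gram_schmidt n ws"
  have gs: "V.span (set ws) = V.span (set us)" "corthogonal us" "set us \<subseteq> carrier_vec n" "distinct us"
    using V.gram_schmidt_result[OF _ ws(2) _ us_def] Sc ws by auto
  have span_us: "V.span (set us) = U"
    using maximal_lin_indpt_vecs_span[OF U S] gs(1) ws(1) by simp
  obtain x where x: "x \<in> carrier_vec n" "x \<notin> U" using proper Uc by auto
  define w where "w = adjuster n x us + x"
  have wc: "w \<in> carrier_vec n" unfolding w_def using V.adjuster_carrier[OF x(1) gs(3) gs(4)] x by auto
  have "w \<noteq> 0\<^sub>v n" unfolding w_def using V.adjust_nonzero[OF gs(3) gs(4) x(1)] x span_us by auto
  have "conjugate w \<in> V.orthogonal_complement (set us)"
    unfolding V.orthogonal_complement_def
  proof (intro CollectI conjI ballI)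
    show "conjugate w \<in> carrier_vec n" using wc by simp
    fix y assume "y \<in> set us"
    then obtain i where i: "i < length us" "y = us ! i" by (auto simp: in_set_conv_nth)
    have "y \<in> carrier_vec n" using i gs(3) by auto
    then have "conjugate w \<bullet> y = conjugate (w \<bullet>c y)"
      using conjugate_sprod_vec[of w n "conjugate y"] wc by simp
    then show "conjugate w \<bullet> y = 0"
      unfolding w_def using V.adjust_zero[OF gs(3) gs(2) x(1) i(1)] i(2) by simp
  qed
  then have "conjugate w \<in> V.orthogonal_complement U"
    using V.in_orthogonal_complement_span[OF gs(3)] span_us by simp
  then have "u \<bullet>c w = 0" if "u \<in> U" for u
  proof -
    have "u \<in> carrier_vec n" using that Uc by auto
    then have "u \<bullet>c w = conjugate w \<bullet> u" using wc by (intro comm_scalar_prod) auto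
    with \<open>conjugate w \<in> V.orthogonal_complement U\<close> that show ?thesis
      unfolding V.orthogonal_complement_def by simp
  qed
  with wc \<open>w \<noteq> 0\<^sub>v n\<close> show thesis by (rule that)
qed

section \<open>The pairing of \<open>H\<^sup>*\<close> with \<open>H\<close> and the forms \<open>b\<close> and \<open>s\<close>\<close>

lemma hom_pairing_add_right:
  fixes f A B :: "complex mat"
  assumes "f \<in> carrier_mat m r" "A \<in> carrier_mat m r" "B \<in> carrier_mat m r"
  shows "hom_pairing r f (A + B) = hom_pairing r f A + hom_pairing r f B"
  unfolding hom_pairing_def using assms
  by (simp add: add_mult_distrib_mat_vec scalar_prod_add_distrib[of _ m] sum.distrib)

lemma hom_pairing_diff_right:
  fixes f A B :: "complex mat"
  assumes "f \<in> carrier_mat m r" "A \<in> carrier_mat m r" "B \<in> carrier_mat m r"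
  shows "hom_pairing r f (A - B) = hom_pairing r f A - hom_pairing r f B"
  unfolding hom_pairing_def using assms
  by (simp add: minus_mult_distrib_mat_vec scalar_prod_minus_distrib[of _ m] sum_subtractf)

lemma hom_pairing_zero_right:
  fixes f :: "complex mat"
  assumes "f \<in> carrier_mat m r"
  shows "hom_pairing r f (0\<^sub>m m r) = 0"
  unfolding hom_pairing_def using assms by (simp add: zero_mat_mult_vec)

lemma hom_pairing_mult_left:
  fixes M f X :: "complex mat"
  assumes M: "M \<in> carrier_mat m m" and f: "f \<in> carrier_mat m r" and X: "X \<in> carrier_mat m r"
  shows "hom_pairing r (M * f) X = hom_pairing r f (transpose_mat M * X)"
  unfolding hom_pairing_def using assms by (simp add: scalar_prod_mult_mat_vec[OF M])

lemma hom_pairing_cnj_self_eq_zero: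
  fixes X :: "complex mat"
  assumes X: "X \<in> carrier_mat m r" and zero: "hom_pairing r (map_mat cnj X) X = 0"
  shows "X = 0\<^sub>m m r"
proof -
  define c where "c i = X *\<^sub>v unit_vec r i" for i
  have c: "c i \<in> carrier_vec m" for i using X by (simp add: c_def)
  have "(map_mat cnj X *\<^sub>v unit_vec r i) \<bullet> (X *\<^sub>v unit_vec r i) = c i \<bullet>c c i" for i
  proof -
    have "conjugate (unit_vec r i) = (unit_vec r i :: complex vec)" by (intro eq_vecI) (auto simp: unit_vec_def)
    then have "map_mat cnj X *\<^sub>v unit_vec r i = conjugate (c i)"
      using map_mat_cnj_mult_vec[OF X, of "unit_vec r i"] by (simp add: c_def)
    then show ?thesis using c by (simp add: c_def comm_scalar_prod[of _ m])
  qed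
  with zero have "(\<Sum>i<r. c i \<bullet>c c i) = 0" by (simp add: hom_pairing_def)
  then have "c i \<bullet>c c i = 0" if "i < r" for i
    using that sum_nonneg_eq_0_iff[of "{..<r}" "\<lambda>i. c i \<bullet>c c i"] by auto
  then have c_zero: "c j = 0\<^sub>v m" if "j < r" for j using that c conjugate_square_eq_0_vec by blast
  show ?thesis
  proof (rule eq_matI)
    fix i j assume "i < dim_row (0\<^sub>m m r)" "j < dim_col (0\<^sub>m m r)"
    then have ij: "i < m" "j < r" by auto
    have "X $$ (i, j) = c j $ i" using X ij by (simp add: c_def)
    with c_zero[OF ij(2)] ij show "X $$ (i, j) = 0\<^sub>m m r $$ (i, j)" by simp
  qed (use X in auto)
qed

definition pairing_form :: "('b \<Rightarrow> 'a \<Rightarrow> complex) \<Rightarrow> 'a \<times> 'b \<Rightarrow> 'a \<times> 'b \<Rightarrow> complex" where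
  "pairing_form p w1 w2 = p (snd w1) (fst w2) + p (snd w2) (fst w1)"

lemma form_b_eq_pairing_form: "form_b = pairing_form (\<bullet>)"
  by (intro ext) (simp add: form_b_def pairing_form_def)

lemma form_s_eq_pairing_form: "form_s r = pairing_form (hom_pairing r)"
  by (intro ext) (simp add: form_s_def pairing_form_def)

lemma respects_isometry_cong:
  assumes "\<And>w. w \<in> S \<Longrightarrow> M w = M' w"
  shows "respects_isometry S F M \<longleftrightarrow> respects_isometry S F M'"
  using bij_betw_cong[of S M M' S] assms unfolding respects_isometry_def by simp

lemma respects_infinitesimally_cong:
  assumes "\<And>w. w \<in> S \<Longrightarrow> M w = M' w"
  shows "respects_infinitesimally S F M \<longleftrightarrow> respects_infinitesimally S F M'"
  using assms unfolding respects_infinitesimally_def by simp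

lemma respects_isometry_pairing_form_iff:
  assumes "z \<in> X" and "y \<in> Y"
  shows "respects_isometry (X \<times> Y) (pairing_form p) (map_prod \<alpha> \<delta>)
    \<longleftrightarrow> bij_betw (map_prod \<alpha> \<delta>) (X \<times> Y) (X \<times> Y) \<and> (\<forall>a\<in>X. \<forall>b\<in>Y. p (\<delta> b) (\<alpha> a) = p b a)"
proof -
  have "(\<forall>w1\<in>X \<times> Y. \<forall>w2\<in>X \<times> Y. pairing_form p (map_prod \<alpha> \<delta> w1) (map_prod \<alpha> \<delta> w2) = pairing_form p w1 w2)
    \<longleftrightarrow> (\<forall>a\<in>X. \<forall>b\<in>Y. p (\<delta> b) (\<alpha> a) = p b a)" (is "?preserves \<longleftrightarrow> _")
  proof (intro iffI ballI)
    fix a b assume preserves: ?preserves and "a \<in> X" "b \<in> Y"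
    define s s' where "s = p (\<delta> y) (\<alpha> z)" and "s' = p y z"
    from preserves assms have "s + s = s' + s'" unfolding s_def s'_def by (fastforce simp: pairing_form_def)
    then have "s = s'" by (simp flip: mult_2)
    moreover from preserves assms \<open>a \<in> X\<close> \<open>b \<in> Y\<close> have "p (\<delta> b) (\<alpha> a) + s = p b a + s'"
      unfolding s_def s'_def by (fastforce simp: pairing_form_def)
    ultimately show "p (\<delta> b) (\<alpha> a) = p b a" by simp
  qed (auto simp: pairing_form_def)
  then show ?thesis unfolding respects_isometry_def by simp
qed

lemma respects_infinitesimally_pairing_form_iff:
  assumes "z \<in> X" and "y \<in> Y"
  shows "respects_infinitesimally (X \<times> Y) (pairing_form p) (map_prod \<alpha> \<delta>)
    \<longleftrightarrow> (\<forall>a\<in>X. \<forall>b\<in>Y. p (\<delta> b) a + p b (\<alpha> a) = 0)"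
  unfolding respects_infinitesimally_def
proof (intro iffI ballI)
  fix a b assume resp: "\<forall>w1\<in>X \<times> Y. \<forall>w2\<in>X \<times> Y.
      pairing_form p (map_prod \<alpha> \<delta> w1) w2 + pairing_form p w1 (map_prod \<alpha> \<delta> w2) = 0"
    and "a \<in> X" "b \<in> Y"
  define s where "s = p (\<delta> y) z + p y (\<alpha> z)"
  from resp assms have "s + s = 0" by (fastforce simp: s_def pairing_form_def algebra_simps)
  then have "s = 0" by (simp flip: mult_2)
  moreover from resp assms \<open>a \<in> X\<close> \<open>b \<in> Y\<close> have "(p (\<delta> b) a + p b (\<alpha> a)) + s = 0"
    by (fastforce simp: s_def pairing_form_def algebra_simps)
  ultimately show "p (\<delta> b) a + p b (\<alpha> a) = 0" by simp
next
  fix w1 w2 assume all: "\<forall>a\<in>X. \<forall>b\<in>Y. p (\<delta> b) a + p b (\<alpha> a) = 0"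
    and "w1 \<in> X \<times> Y" "w2 \<in> X \<times> Y"
  then show "pairing_form p (map_prod \<alpha> \<delta> w1) w2 + pairing_form p w1 (map_prod \<alpha> \<delta> w2) = 0"
  proof (cases w1; cases w2)
    fix a1 b1 a2 b2 assume w: "w1 = (a1, b1)" "w2 = (a2, b2)"
    with all \<open>w1 \<in> X \<times> Y\<close> \<open>w2 \<in> X \<times> Y\<close>
    have "p (\<delta> b1) a2 + p b1 (\<alpha> a2) = 0" "p (\<delta> b2) a1 + p b2 (\<alpha> a1) = 0" by auto
    moreover have "pairing_form p (map_prod \<alpha> \<delta> w1) w2 + pairing_form p w1 (map_prod \<alpha> \<delta> w2)
      = (p (\<delta> b1) a2 + p b1 (\<alpha> a2)) + (p (\<delta> b2) a1 + p b2 (\<alpha> a1))"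
      unfolding w pairing_form_def by (simp add: algebra_simps)
    ultimately show ?thesis by simp
  qed
qed

lemma respects_isometry_form_b_iff:
  fixes MV MD :: "complex mat"
  assumes MV: "MV \<in> carrier_mat m m" and MD: "MD \<in> carrier_mat m m"
  shows "respects_isometry (carrier_vec m \<times> carrier_vec m) form_b (map_prod ((*\<^sub>v) MV) ((*\<^sub>v) MD))
    \<longleftrightarrow> transpose_mat MD * MV = 1\<^sub>m m"
proof -
  have pairing: "(MD *\<^sub>v f) \<bullet> (MV *\<^sub>v v) = f \<bullet> ((transpose_mat MD * MV) *\<^sub>v v)"
    if "f \<in> carrier_vec m" "v \<in> carrier_vec m" for f v
    using scalar_prod_mult_mat_vec[OF MD that(1), of "MV *\<^sub>v v"] that MV MD by simp
  have "(\<forall>v\<in>carrier_vec m. \<forall>f\<in>carrier_vec m. (MD *\<^sub>v f) \<bullet> (MV *\<^sub>v v) = f \<bullet> v)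
    \<longleftrightarrow> transpose_mat MD * MV = 1\<^sub>m m"
  proof
    assume "\<forall>v\<in>carrier_vec m. \<forall>f\<in>carrier_vec m. (MD *\<^sub>v f) \<bullet> (MV *\<^sub>v v) = f \<bullet> v"
    then show "transpose_mat MD * MV = 1\<^sub>m m"
      using MV MD by (intro eq_mat_by_scalar_prodI) (auto simp flip: pairing)
  qed (simp add: pairing)
  moreover have "bij_betw (map_prod ((*\<^sub>v) MV) ((*\<^sub>v) MD)) (carrier_vec m \<times> carrier_vec m) (carrier_vec m \<times> carrier_vec m)"
    if inverse: "transpose_mat MD * MV = 1\<^sub>m m"
    using bij_betw_mult_mat_vec[OF MV _ inverse] bij_betw_mult_mat_vec[OF MD _ transpose_mult_eq_one_swap[OF MV MD inverse]]
      MV MD by (auto intro: bij_betw_map_prod)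
  ultimately show ?thesis
    unfolding form_b_eq_pairing_form respects_isometry_pairing_form_iff[OF zero_carrier_vec zero_carrier_vec]
    by blast
qed

lemma respects_infinitesimally_form_b_iff:
  fixes MV MD :: "complex mat"
  assumes MV: "MV \<in> carrier_mat m m" and MD: "MD \<in> carrier_mat m m"
  shows "respects_infinitesimally (carrier_vec m \<times> carrier_vec m) form_b (map_prod ((*\<^sub>v) MV) ((*\<^sub>v) MD))
    \<longleftrightarrow> transpose_mat MD + MV = 0\<^sub>m m m"
proof -
  have pairing: "(MD *\<^sub>v f) \<bullet> v + f \<bullet> (MV *\<^sub>v v) = f \<bullet> ((transpose_mat MD + MV) *\<^sub>v v)"
    if "f \<in> carrier_vec m" "v \<in> carrier_vec m" for f v
    using scalar_prod_mult_mat_vec[OF MD that] that MV MD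
    by (simp add: add_mult_distrib_mat_vec[of _ m m] scalar_prod_add_distrib[of _ m])
  have "(\<forall>v\<in>carrier_vec m. \<forall>f\<in>carrier_vec m. (MD *\<^sub>v f) \<bullet> v + f \<bullet> (MV *\<^sub>v v) = 0)
    \<longleftrightarrow> transpose_mat MD + MV = 0\<^sub>m m m"
  proof
    assume "\<forall>v\<in>carrier_vec m. \<forall>f\<in>carrier_vec m. (MD *\<^sub>v f) \<bullet> v + f \<bullet> (MV *\<^sub>v v) = 0"
    then show "transpose_mat MD + MV = 0\<^sub>m m m"
      using MV MD by (intro eq_mat_by_scalar_prodI) (auto simp: zero_mat_mult_vec simp flip: pairing)
  qed (simp add: pairing zero_mat_mult_vec)
  then show ?thesis
    unfolding form_b_eq_pairing_form respects_infinitesimally_pairing_form_iff[OF zero_carrier_vec zero_carrier_vec] .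
qed

section \<open>Isotypic representations\<close>

locale isotypic_rep =
  fixes G :: "('g, 'b) monoid_scheme" and T :: "'g topology"
    and r :: nat and \<rho> :: "'g \<Rightarrow> complex mat"
    and m :: nat and \<sigma> :: "'g \<Rightarrow> complex mat"
  assumes group: "group G"
    and R_rep: "unitary_rep G T r \<rho>" and R_irr: "irreducible_rep G r \<rho>"
    and V_rep: "unitary_rep G T m \<sigma>"
    and V_isotypic: "\<forall>W. irreducible_subrep G m \<sigma> W \<longrightarrow> rep_iso_to G r \<rho> m \<sigma> W"
begin

abbreviation H where "H \<equiv> hom_space G r \<rho> m \<sigma>"

abbreviation Hd where "Hd \<equiv> hom_space G r (dual_rep G \<rho>) m (dual_rep G \<sigma>)"

lemma
  shows rho_carrier: "\<rho> ` carrier G \<subseteq> carrier_mat r r"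
    and sigma_carrier: "\<sigma> ` carrier G \<subseteq> carrier_mat m m"
    and rho_dual_carrier: "dual_rep G \<rho> ` carrier G \<subseteq> carrier_mat r r"
    and sigma_dual_carrier: "dual_rep G \<sigma> ` carrier G \<subseteq> carrier_mat m m"
  using unitary_rep_carrier[OF R_rep] unitary_rep_carrier[OF V_rep]
    dual_rep_carrier[OF group unitary_rep_carrier[OF R_rep]]
    dual_rep_carrier[OF group unitary_rep_carrier[OF V_rep]] by auto

lemma hom_into_invariant_subspace:
  assumes K: "invariant_subspace G m \<sigma> K" and nonzero: "K \<noteq> {0\<^sub>v m}"
  obtains h where "h \<in> H" "h \<noteq> 0\<^sub>m m r" "\<And>x. x \<in> carrier_vec r \<Longrightarrow> h *\<^sub>v x \<in> K"
proof -
  obtain W where W: "W \<subseteq> K" "irreducible_subrep G m \<sigma> W"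
    using exists_irreducible_subrep[OF K nonzero] by blast
  then obtain \<phi> where bij: "bij_betw \<phi> (carrier_vec r) W"
    and add: "\<forall>x\<in>carrier_vec r. \<forall>y\<in>carrier_vec r. \<phi> (x + y) = \<phi> x + \<phi> y"
    and smult: "\<forall>c. \<forall>x\<in>carrier_vec r. \<phi> (c \<cdot>\<^sub>v x) = c \<cdot>\<^sub>v \<phi> x"
    and equivariant: "\<forall>g\<in>carrier G. \<forall>x\<in>carrier_vec r. \<phi> (\<rho> g *\<^sub>v x) = \<sigma> g *\<^sub>v \<phi> x"
    using V_isotypic unfolding rep_iso_to_def by blast
  have "W \<subseteq> carrier_vec m" and "W \<noteq> {0\<^sub>v m}" and "0\<^sub>v m \<in> W"
    using W(2) unfolding irreducible_subrep_def invariant_subspace_def csubspace_of_def by auto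
  then obtain w where w: "w \<in> W" "w \<noteq> 0\<^sub>v m" and W_carrier: "W \<subseteq> carrier_vec m" by auto
  have \<phi>W: "\<phi> x \<in> W" if "x \<in> carrier_vec r" for x using bij that unfolding bij_betw_def by auto
  have "\<exists>M\<in>H. \<forall>x\<in>carrier_vec r. \<phi> x = M *\<^sub>v x"
    by (rule equivariant_linear_map_is_hom[OF rho_carrier sigma_carrier])
      (use \<phi>W W_carrier add smult equivariant in auto)
  then obtain h where h: "h \<in> H" and \<phi>h: "\<And>x. x \<in> carrier_vec r \<Longrightarrow> \<phi> x = h *\<^sub>v x" by blast
  obtain x where x: "x \<in> carrier_vec r" "\<phi> x = w" using bij w(1) unfolding bij_betw_def by auto
  have "h \<noteq> 0\<^sub>m m r"
  proof
    assume "h = 0\<^sub>m m r"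
    then have "w = 0\<^sub>v m" using x \<phi>h zero_mat_mult_vec by metis
    with w(2) show False ..
  qed
  with h \<phi>h \<phi>W W(1) show thesis by (intro that) auto
qed

text \<open>The orthogonal complement of the images of \<open>H\<close> is \<open>\<sigma>\<close>-invariant because \<open>\<sigma>\<close> is
  unitary; by isotypy it would contain the image of a nonzero element of \<open>H\<close> if it were nonzero.\<close>

lemma hom_images_orthogonal_eq_zero:
  assumes w: "w \<in> carrier_vec m"
    and orth: "\<And>h x. h \<in> H \<Longrightarrow> x \<in> carrier_vec r \<Longrightarrow> (h *\<^sub>v x) \<bullet>c w = 0"
  shows "w = 0\<^sub>v m"
proof (rule ccontr)
  assume "w \<noteq> 0\<^sub>v m"
  define S where "S = {h *\<^sub>v x | h x. h \<in> H \<and> x \<in> carrier_vec r}"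
  define K where "K = {w \<in> carrier_vec m. \<forall>u\<in>S. u \<bullet>c w = 0}"
  have S_carrier: "S \<subseteq> carrier_vec m" unfolding S_def by (auto dest: hom_spaceD)
  have "\<sigma> g *\<^sub>v k \<in> K" if g: "g \<in> carrier G" and k: "k \<in> K" for g k
  proof -
    have g': "inv\<^bsub>G\<^esub> g \<in> carrier G" using group g by (simp add: group.inv_closed)
    have \<sigma>g: "\<sigma> g \<in> carrier_mat m m" using sigma_carrier g by auto
    have "(h *\<^sub>v x) \<bullet>c (\<sigma> g *\<^sub>v k) = 0" if h: "h \<in> H" and x: "x \<in> carrier_vec r" for h x
    proof -
      have "\<rho> (inv\<^bsub>G\<^esub> g) *\<^sub>v x \<in> carrier_vec r" using rho_carrier g' x by auto
      then have "h *\<^sub>v (\<rho> (inv\<^bsub>G\<^esub> g) *\<^sub>v x) \<in> S" using h unfolding S_def by blast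
      moreover have "(h *\<^sub>v x) \<bullet>c (\<sigma> g *\<^sub>v k) = (\<sigma> (inv\<^bsub>G\<^esub> g) *\<^sub>v (h *\<^sub>v x)) \<bullet>c k"
        using cscalar_prod_mult_mat_vec[OF \<sigma>g, of "h *\<^sub>v x" k] h x k
        by (auto simp: unitary_rep_inv[OF group V_rep g] K_def dest: hom_spaceD)
      ultimately show ?thesis
        using k hom_space_mult_vec[OF h rho_carrier sigma_carrier g' x] unfolding K_def by simp
    qed
    then show ?thesis using k \<sigma>g unfolding K_def S_def by auto
  qed
  then have "invariant_subspace G m \<sigma> K"
    unfolding invariant_subspace_def K_def using csubspace_of_orthogonal[OF S_carrier] by blast
  moreover have "K \<noteq> {0\<^sub>v m}" using w orth \<open>w \<noteq> 0\<^sub>v m\<close> unfolding K_def S_def by blast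
  ultimately obtain h where h: "h \<in> H" "h \<noteq> 0\<^sub>m m r" and hK: "\<And>x. x \<in> carrier_vec r \<Longrightarrow> h *\<^sub>v x \<in> K"
    using hom_into_invariant_subspace by blast
  have "h *\<^sub>v x = 0\<^sub>v m" if x: "x \<in> carrier_vec r" for x
  proof -
    have "h *\<^sub>v x \<in> S" using h x unfolding S_def by blast
    then have "(h *\<^sub>v x) \<bullet>c (h *\<^sub>v x) = 0" using hK[OF x] unfolding K_def by blast
    moreover have "h *\<^sub>v x \<in> carrier_vec m" using hK[OF x] unfolding K_def by blast
    ultimately show ?thesis using conjugate_square_eq_0_vec by blast
  qed
  then have "h = 0\<^sub>m m r"
    using h by (intro eq_mat_by_mult_vecI) (auto simp: zero_mat_mult_vec dest: hom_spaceD)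
  with h(2) show False ..
qed

lemma subspace_containing_hom_images:
  assumes U: "csubspace_of m U" and images: "\<And>h x. h \<in> H \<Longrightarrow> x \<in> carrier_vec r \<Longrightarrow> h *\<^sub>v x \<in> U"
  shows "U = carrier_vec m"
proof (rule ccontr)
  assume "U \<noteq> carrier_vec m"
  then obtain w where "w \<in> carrier_vec m" "w \<noteq> 0\<^sub>v m" "\<And>u. u \<in> U \<Longrightarrow> u \<bullet>c w = 0"
    using exists_orthogonal_vec[OF U] by blast
  with images hom_images_orthogonal_eq_zero show False by blast
qed

lemma eq_mat_by_hom_spaceI:
  assumes N1: "N1 \<in> carrier_mat k m" and N2: "N2 \<in> carrier_mat k m"
    and eq: "\<And>h. h \<in> H \<Longrightarrow> N1 * h = N2 * h"
  shows "N1 = N2"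
proof -
  have "{v \<in> carrier_vec m. N1 *\<^sub>v v = N2 *\<^sub>v v} = carrier_vec m"
  proof (rule subspace_containing_hom_images)
    show "csubspace_of m {v \<in> carrier_vec m. N1 *\<^sub>v v = N2 *\<^sub>v v}" by (rule csubspace_of_mat_eq[OF N1 N2])
    fix h and x :: "complex vec" assume h: "h \<in> H" and x: "x \<in> carrier_vec r"
    have "h \<in> carrier_mat m r" using h by (rule hom_spaceD)
    with N1 N2 x eq[OF h] show "h *\<^sub>v x \<in> {v \<in> carrier_vec m. N1 *\<^sub>v v = N2 *\<^sub>v v}"
      by (auto simp flip: assoc_mult_mat_vec)
  qed
  then show ?thesis using N1 N2 by (intro eq_mat_by_mult_vecI) auto
qed

lemma cnj_mem_dual_hom_space: "h \<in> H \<Longrightarrow> map_mat cnj h \<in> Hd"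
  by (rule cnj_mem_hom_space[OF rho_carrier sigma_carrier])
    (simp_all add: dual_rep_unitary[OF group R_rep] dual_rep_unitary[OF group V_rep])

lemma endomorphism_eq_by_hom_pairing:
  assumes N1: "N1 \<in> hom_space G m \<sigma> m \<sigma>" and N2: "N2 \<in> hom_space G m \<sigma> m \<sigma>"
    and pairing: "\<And>f h. f \<in> Hd \<Longrightarrow> h \<in> H \<Longrightarrow> hom_pairing r f (N1 * h) = hom_pairing r f (N2 * h)"
  shows "N1 = N2"
proof (rule eq_mat_by_hom_spaceI)
  show N1c: "N1 \<in> carrier_mat m m" and N2c: "N2 \<in> carrier_mat m m" using N1 N2 by (auto dest: hom_spaceD)
  fix h assume h: "h \<in> H"
  have N1h: "N1 * h \<in> H" and N2h: "N2 * h \<in> H"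
    using mult_mem_hom_space[OF rho_carrier sigma_carrier sigma_carrier h] N1 N2 by auto
  then have X: "N1 * h - N2 * h \<in> H" by (rule diff_mem_hom_space[OF rho_carrier sigma_carrier])
  have Xc: "N1 * h - N2 * h \<in> carrier_mat m r" and N1hc: "N1 * h \<in> carrier_mat m r"
    and N2hc: "N2 * h \<in> carrier_mat m r"
    using X N1h N2h by (auto dest: hom_spaceD)
  have "hom_pairing r (map_mat cnj (N1 * h - N2 * h)) (N1 * h - N2 * h) = 0"
    using pairing[OF cnj_mem_dual_hom_space[OF X] h] Xc N1hc N2hc
    by (simp add: hom_pairing_diff_right[of _ m r])
  then have zero: "N1 * h - N2 * h = 0\<^sub>m m r" by (rule hom_pairing_cnj_self_eq_zero[OF Xc])
  show "N1 * h = N2 * h"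
  proof (rule eq_matI)
    fix i j assume ij: "i < dim_row (N2 * h)" "j < dim_col (N2 * h)"
    then have "(N1 * h - N2 * h) $$ (i, j) = 0" using zero N2c hom_spaceD(1)[OF h] by simp
    with ij show "(N1 * h) $$ (i, j) = (N2 * h) $$ (i, j)" by simp
  qed (use N1c N2c in auto)
qed

lemma hom_to_dual_eq_zero:
  assumes not_self_dual: "\<not> rep_iso_to G r \<rho> r (dual_rep G \<rho>) (carrier_vec r)"
    and C: "C \<in> hom_space G m \<sigma> m (dual_rep G \<sigma>)"
  shows "C = 0\<^sub>m m m"
proof -
  have Cc: "C \<in> carrier_mat m m" using C by (rule hom_spaceD)
  have zero_left: "transpose_mat h' * C = 0\<^sub>m r m" if h': "h' \<in> H" for h'
  proof (rule eq_mat_by_hom_spaceI)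
    show "transpose_mat h' * C \<in> carrier_mat r m" "0\<^sub>m r m \<in> carrier_mat r m"
      using Cc hom_spaceD(1)[OF h'] by auto
    fix h assume h: "h \<in> H"
    have "transpose_mat h' \<in> hom_space G m (dual_rep G \<sigma>) r (dual_rep G \<rho>)"
      by (rule transpose_mem_hom_space_dual[OF group rho_carrier sigma_carrier h'])
    then have "transpose_mat h' * C \<in> hom_space G m \<sigma> r (dual_rep G \<rho>)"
      by (rule mult_mem_hom_space[OF sigma_carrier sigma_dual_carrier rho_dual_carrier C])
    then have "transpose_mat h' * C * h \<in> hom_space G r \<rho> r (dual_rep G \<rho>)"
      by (rule mult_mem_hom_space[OF rho_carrier sigma_carrier rho_dual_carrier h])
    then have "transpose_mat h' * C * h = 0\<^sub>m r r"
      by (rule hom_space_eq_zero_if_not_iso[OF R_irr rho_carrier rho_dual_carrier _ not_self_dual])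
    then show "transpose_mat h' * C * h = 0\<^sub>m r m * h" using hom_spaceD(1)[OF h] by simp
  qed
  have tC: "transpose_mat C * h' = 0\<^sub>m m m * h'" if h': "h' \<in> H" for h'
  proof -
    have h'c: "h' \<in> carrier_mat m r" using h' by (rule hom_spaceD)
    have "transpose_mat C * h' = transpose_mat (transpose_mat h' * C)"
      using transpose_mult[of "transpose_mat h'" r m C m] h'c Cc by simp
    also have "\<dots> = 0\<^sub>m m r" using zero_left[OF h'] by (auto intro!: eq_matI)
    also have "\<dots> = 0\<^sub>m m m * h'" using h'c by simp
    finally show ?thesis .
  qed
  have "transpose_mat C = 0\<^sub>m m m" by (rule eq_mat_by_hom_spaceI[OF _ _ tC]) (use Cc in auto)
  then have "transpose_mat (transpose_mat C) = 0\<^sub>m m m" by (auto intro!: eq_matI)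
  then show ?thesis by simp
qed

lemma hom_from_dual_eq_zero:
  assumes not_self_dual: "\<not> rep_iso_to G r \<rho> r (dual_rep G \<rho>) (carrier_vec r)"
    and B: "B \<in> hom_space G m (dual_rep G \<sigma>) m \<sigma>"
  shows "B = 0\<^sub>m m m"
proof -
  have "map_mat cnj B \<in> hom_space G m \<sigma> m (dual_rep G \<sigma>)"
    by (rule cnj_mem_hom_space[OF sigma_dual_carrier sigma_carrier _ _ B])
      (simp_all add: dual_rep_unitary[OF group V_rep])
  then have "map_mat cnj B = 0\<^sub>m m m" by (rule hom_to_dual_eq_zero[OF not_self_dual])
  then have "map_mat cnj (map_mat cnj B) = 0\<^sub>m m m" by auto
  then show ?thesis by simp
qed

lemma transpose_endomorphisms:
  assumes MV: "MV \<in> hom_space G m \<sigma> m \<sigma>" and MD: "MD \<in> hom_space G m (dual_rep G \<sigma>) m (dual_rep G \<sigma>)"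
  shows "transpose_mat MD \<in> hom_space G m \<sigma> m \<sigma>"
    and "transpose_mat MV \<in> hom_space G m (dual_rep G \<sigma>) m (dual_rep G \<sigma>)"
  using transpose_mem_hom_space_dual[OF group sigma_dual_carrier sigma_dual_carrier MD]
    transpose_mem_hom_space_dual[OF group sigma_carrier sigma_carrier MV]
  by (simp_all add: hom_space_dual_dual[OF group])

lemma respects_isometry_form_s_iff:
  assumes MV: "MV \<in> hom_space G m \<sigma> m \<sigma>" and MD: "MD \<in> hom_space G m (dual_rep G \<sigma>) m (dual_rep G \<sigma>)"
  shows "respects_isometry (H \<times> Hd) (form_s r) (map_prod ((*) MV) ((*) MD)) \<longleftrightarrow> transpose_mat MD * MV = 1\<^sub>m m"
proof -
  have MVc: "MV \<in> carrier_mat m m" and MDc: "MD \<in> carrier_mat m m" using MV MD by (auto dest: hom_spaceD)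
  have MVH: "MV * h \<in> H" if "h \<in> H" for h using mult_mem_hom_space[OF rho_carrier sigma_carrier sigma_carrier that MV] .
  have pairing: "hom_pairing r (MD * f) (MV * h) = hom_pairing r f ((transpose_mat MD * MV) * h)"
    if "f \<in> Hd" "h \<in> H" for f h
    using hom_pairing_mult_left[OF MDc, of f r "MV * h"] that MVc MDc by (auto simp: assoc_mult_mat dest!: hom_spaceD(1))
  have "(\<forall>h\<in>H. \<forall>f\<in>Hd. hom_pairing r (MD * f) (MV * h) = hom_pairing r f h) \<longleftrightarrow> transpose_mat MD * MV = 1\<^sub>m m"
  proof
    assume "\<forall>h\<in>H. \<forall>f\<in>Hd. hom_pairing r (MD * f) (MV * h) = hom_pairing r f h"
    then show "transpose_mat MD * MV = 1\<^sub>m m"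
      using mult_mem_hom_space[OF sigma_carrier sigma_carrier sigma_carrier MV transpose_endomorphisms(1)[OF MV MD]]
        one_mem_hom_space[OF sigma_carrier]
      by (intro endomorphism_eq_by_hom_pairing) (auto simp: pairing dest: hom_spaceD(1))
  qed (auto simp: pairing dest: hom_spaceD(1))
  moreover have "bij_betw (map_prod ((*) MV) ((*) MD)) (H \<times> Hd) (H \<times> Hd)"
    if inverse: "transpose_mat MD * MV = 1\<^sub>m m"
  proof (rule bij_betw_map_prod)
    show "bij_betw ((*) MV) H H"
      using transpose_endomorphisms(1)[OF MV MD] MVH
      by (intro bij_betw_mult_mat[OF MVc _ inverse])
        (auto intro: mult_mem_hom_space[OF rho_carrier sigma_carrier sigma_carrier] dest: hom_spaceD(1))
    show "bij_betw ((*) MD) Hd Hd"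
      using transpose_endomorphisms(2)[OF MV MD] MD
      by (intro bij_betw_mult_mat[OF MDc _ transpose_mult_eq_one_swap[OF MVc MDc inverse]])
        (auto intro: mult_mem_hom_space[OF rho_dual_carrier sigma_dual_carrier sigma_dual_carrier]
          dest: hom_spaceD(1))
  qed
  ultimately show ?thesis
    unfolding form_s_eq_pairing_form
      respects_isometry_pairing_form_iff[OF zero_mem_hom_space[OF rho_carrier sigma_carrier]
        zero_mem_hom_space[OF rho_dual_carrier sigma_dual_carrier]]
    by blast
qed

lemma respects_infinitesimally_form_s_iff:
  assumes MV: "MV \<in> hom_space G m \<sigma> m \<sigma>" and MD: "MD \<in> hom_space G m (dual_rep G \<sigma>) m (dual_rep G \<sigma>)"
  shows "respects_infinitesimally (H \<times> Hd) (form_s r) (map_prod ((*) MV) ((*) MD))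
    \<longleftrightarrow> transpose_mat MD + MV = 0\<^sub>m m m"
proof -
  have MVc: "MV \<in> carrier_mat m m" and MDc: "MD \<in> carrier_mat m m" using MV MD by (auto dest: hom_spaceD)
  have pairing: "hom_pairing r (MD * f) h + hom_pairing r f (MV * h) = hom_pairing r f ((transpose_mat MD + MV) * h)"
    if "f \<in> Hd" "h \<in> H" for f h
    using hom_pairing_mult_left[OF MDc, of f r h] hom_pairing_add_right[of f m r] that MVc MDc
    by (auto simp: add_mult_distrib_mat dest!: hom_spaceD(1))
  have zero: "hom_pairing r f (0\<^sub>m m m * h) = 0" if "f \<in> Hd" "h \<in> H" for f h
    using hom_pairing_zero_right[of f m r] that by (auto dest!: hom_spaceD(1))
  have "transpose_mat MD + MV \<in> hom_space G m \<sigma> m \<sigma>"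
    using add_mem_hom_space[OF sigma_carrier sigma_carrier transpose_endomorphisms(1)[OF MV MD] MV] .
  then show ?thesis
    unfolding form_s_eq_pairing_form
      respects_infinitesimally_pairing_form_iff[OF zero_mem_hom_space[OF rho_carrier sigma_carrier]
        zero_mem_hom_space[OF rho_dual_carrier sigma_dual_carrier]]
    using zero_mem_hom_space[OF sigma_carrier sigma_carrier] MVc MDc
    by (auto simp: pairing zero intro: endomorphism_eq_by_hom_pairing)
qed

lemma block_diagonal_respects_forms_iff:
  assumes MV: "MV \<in> hom_space G m \<sigma> m \<sigma>" and MD: "MD \<in> hom_space G m (dual_rep G \<sigma>) m (dual_rep G \<sigma>)"
    and \<Phi>: "\<And>v f. v \<in> carrier_vec m \<Longrightarrow> f \<in> carrier_vec m \<Longrightarrow> \<Phi> (v, f) = (MV *\<^sub>v v, MD *\<^sub>v f)"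
    and A: "\<And>h. h \<in> H \<Longrightarrow> A h = MV * h" and D: "\<And>f. f \<in> Hd \<Longrightarrow> D f = MD * f"
  shows "respects_isometry (carrier_vec m \<times> carrier_vec m) form_b \<Phi>
      \<longleftrightarrow> respects_isometry (H \<times> Hd) (form_s r) (\<lambda>(h, f). (A h, D f))"
    and "respects_infinitesimally (carrier_vec m \<times> carrier_vec m) form_b \<Phi>
      \<longleftrightarrow> respects_infinitesimally (H \<times> Hd) (form_s r) (\<lambda>(h, f). (A h, D f))"
proof -
  have MVc: "MV \<in> carrier_mat m m" and MDc: "MD \<in> carrier_mat m m" using MV MD by (auto dest: hom_spaceD)
  have \<Phi>_eq: "\<Phi> w = map_prod ((*\<^sub>v) MV) ((*\<^sub>v) MD) w" if "w \<in> carrier_vec m \<times> carrier_vec m" for w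
    using that \<Phi> by auto
  have AD_eq: "map_prod ((*) MV) ((*) MD) w = (\<lambda>(h, f). (A h, D f)) w" if "w \<in> H \<times> Hd" for w
    using that A D by auto
  have "respects_isometry (carrier_vec m \<times> carrier_vec m) form_b \<Phi>
      \<longleftrightarrow> respects_isometry (carrier_vec m \<times> carrier_vec m) form_b (map_prod ((*\<^sub>v) MV) ((*\<^sub>v) MD))"
    by (rule respects_isometry_cong) (rule \<Phi>_eq)
  also have "\<dots> \<longleftrightarrow> transpose_mat MD * MV = 1\<^sub>m m" by (rule respects_isometry_form_b_iff[OF MVc MDc])
  also have "\<dots> \<longleftrightarrow> respects_isometry (H \<times> Hd) (form_s r) (map_prod ((*) MV) ((*) MD))"
    by (rule respects_isometry_form_s_iff[OF MV MD, symmetric])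
  also have "\<dots> \<longleftrightarrow> respects_isometry (H \<times> Hd) (form_s r) (\<lambda>(h, f). (A h, D f))"
    by (rule respects_isometry_cong) (rule AD_eq)
  finally show "respects_isometry (carrier_vec m \<times> carrier_vec m) form_b \<Phi>
      \<longleftrightarrow> respects_isometry (H \<times> Hd) (form_s r) (\<lambda>(h, f). (A h, D f))" .
  have "respects_infinitesimally (carrier_vec m \<times> carrier_vec m) form_b \<Phi>
      \<longleftrightarrow> respects_infinitesimally (carrier_vec m \<times> carrier_vec m) form_b (map_prod ((*\<^sub>v) MV) ((*\<^sub>v) MD))"
    by (rule respects_infinitesimally_cong) (rule \<Phi>_eq)
  also have "\<dots> \<longleftrightarrow> transpose_mat MD + MV = 0\<^sub>m m m" by (rule respects_infinitesimally_form_b_iff[OF MVc MDc])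
  also have "\<dots> \<longleftrightarrow> respects_infinitesimally (H \<times> Hd) (form_s r) (map_prod ((*) MV) ((*) MD))"
    by (rule respects_infinitesimally_form_s_iff[OF MV MD, symmetric])
  also have "\<dots> \<longleftrightarrow> respects_infinitesimally (H \<times> Hd) (form_s r) (\<lambda>(h, f). (A h, D f))"
    by (rule respects_infinitesimally_cong) (rule AD_eq)
  finally show "respects_infinitesimally (carrier_vec m \<times> carrier_vec m) form_b \<Phi>
      \<longleftrightarrow> respects_infinitesimally (H \<times> Hd) (form_s r) (\<lambda>(h, f). (A h, D f))" .
qed

lemma left_mult_block_maps:
  assumes MV: "MV \<in> hom_space G m \<sigma> m \<sigma>" and MD: "MD \<in> hom_space G m (dual_rep G \<sigma>) m (dual_rep G \<sigma>)"
    and \<Phi>: "\<And>v f. v \<in> carrier_vec m \<Longrightarrow> f \<in> carrier_vec m \<Longrightarrow> \<Phi> (v, f) = (MV *\<^sub>v v, MD *\<^sub>v f)"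
  shows "(*) MV ` H \<subseteq> H" and "clinear_on H ((*) MV) (+) (\<cdot>\<^sub>m) (+) (\<cdot>\<^sub>m)"
    and "(*) MD ` Hd \<subseteq> Hd" and "clinear_on Hd ((*) MD) (+) (\<cdot>\<^sub>m) (+) (\<cdot>\<^sub>m)"
    and "\<And>h x. h \<in> H \<Longrightarrow> x \<in> carrier_vec r \<Longrightarrow> \<Phi> (h *\<^sub>v x, 0\<^sub>v m) = (MV * h *\<^sub>v x, 0\<^sub>v m)"
    and "\<And>f t. f \<in> Hd \<Longrightarrow> t \<in> carrier_vec r \<Longrightarrow> \<Phi> (0\<^sub>v m, f *\<^sub>v t) = (0\<^sub>v m, MD * f *\<^sub>v t)"
proof -
  have MVc: "MV \<in> carrier_mat m m" and MDc: "MD \<in> carrier_mat m m" using MV MD by (auto dest: hom_spaceD)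
  show "(*) MV ` H \<subseteq> H" using mult_mem_hom_space[OF rho_carrier sigma_carrier sigma_carrier _ MV] by auto
  show "(*) MD ` Hd \<subseteq> Hd"
    using mult_mem_hom_space[OF rho_dual_carrier sigma_dual_carrier sigma_dual_carrier _ MD] by auto
  show "clinear_on H ((*) MV) (+) (\<cdot>\<^sub>m) (+) (\<cdot>\<^sub>m)" by (rule clinear_on_mult_mat[OF MVc]) (auto dest: hom_spaceD)
  show "clinear_on Hd ((*) MD) (+) (\<cdot>\<^sub>m) (+) (\<cdot>\<^sub>m)" by (rule clinear_on_mult_mat[OF MDc]) (auto dest: hom_spaceD)
  show "\<Phi> (h *\<^sub>v x, 0\<^sub>v m) = (MV * h *\<^sub>v x, 0\<^sub>v m)" if "h \<in> H" "x \<in> carrier_vec r" for h x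
    using that \<Phi> MVc MDc by (auto simp: mult_mat_vec_zero dest!: hom_spaceD(1))
  show "\<Phi> (0\<^sub>v m, f *\<^sub>v t) = (0\<^sub>v m, MD * f *\<^sub>v t)" if "f \<in> Hd" "t \<in> carrier_vec r" for f t
    using that \<Phi> MVc MDc by (auto simp: mult_mat_vec_zero dest!: hom_spaceD(1))
qed

end

locale equivariant_pair_map = isotypic_rep +
  fixes \<Phi> :: "complex vec \<times> complex vec \<Rightarrow> complex vec \<times> complex vec"
  assumes not_self_dual: "\<not> rep_iso_to G r \<rho> r (dual_rep G \<rho>) (carrier_vec r)"
    and \<Phi>_maps_to: "\<Phi> ` (carrier_vec m \<times> carrier_vec m) \<subseteq> carrier_vec m \<times> carrier_vec m"
    and \<Phi>_clinear: "clinear_on (carrier_vec m \<times> carrier_vec m) \<Phi> vpair_add vpair_smult vpair_add vpair_smult"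
    and \<Phi>_commutes: "\<forall>g\<in>carrier G. \<forall>v\<in>carrier_vec m. \<forall>f\<in>carrier_vec m.
          \<Phi> (\<sigma> g *\<^sub>v v, dual_rep G \<sigma> g *\<^sub>v f)
            = (\<sigma> g *\<^sub>v fst (\<Phi> (v, f)), dual_rep G \<sigma> g *\<^sub>v snd (\<Phi> (v, f)))"
begin

lemma component_carrier:
  assumes "v \<in> carrier_vec m" and "f \<in> carrier_vec m"
  shows "fst (\<Phi> (v, f)) \<in> carrier_vec m" and "snd (\<Phi> (v, f)) \<in> carrier_vec m"
  using \<Phi>_maps_to assms by force+

lemma commutes_partial:
  assumes "g \<in> carrier G" and "v \<in> carrier_vec m"
  shows "\<Phi> (\<sigma> g *\<^sub>v v, 0\<^sub>v m) = (\<sigma> g *\<^sub>v fst (\<Phi> (v, 0\<^sub>v m)), dual_rep G \<sigma> g *\<^sub>v snd (\<Phi> (v, 0\<^sub>v m)))"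
    and "\<Phi> (0\<^sub>v m, dual_rep G \<sigma> g *\<^sub>v v) = (\<sigma> g *\<^sub>v fst (\<Phi> (0\<^sub>v m, v)), dual_rep G \<sigma> g *\<^sub>v snd (\<Phi> (0\<^sub>v m, v)))"
  using \<Phi>_commutes[rule_format, of g v "0\<^sub>v m"] \<Phi>_commutes[rule_format, of g "0\<^sub>v m" v] assms
    mult_mat_vec_zero[of "\<sigma> g" m m] mult_mat_vec_zero[of "dual_rep G \<sigma> g" m m]
    sigma_carrier sigma_dual_carrier by auto

lemma off_diagonal_blocks_zero:
  assumes v: "v \<in> carrier_vec m"
  shows "snd (\<Phi> (v, 0\<^sub>v m)) = 0\<^sub>v m" and "fst (\<Phi> (0\<^sub>v m, v)) = 0\<^sub>v m"
proof -
  note partial = clinear_on_pair_partial[OF \<Phi>_clinear]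
  have "\<exists>M\<in>hom_space G m \<sigma> m (dual_rep G \<sigma>). \<forall>v\<in>carrier_vec m. snd (\<Phi> (v, 0\<^sub>v m)) = M *\<^sub>v v"
    by (rule equivariant_linear_map_is_hom[OF sigma_carrier sigma_dual_carrier, where f = "\<lambda>v. snd (\<Phi> (v, 0\<^sub>v m))"])
      (use component_carrier partial(1-4) commutes_partial(1) in \<open>auto simp: vpair_add_def vpair_smult_def\<close>)
  then show "snd (\<Phi> (v, 0\<^sub>v m)) = 0\<^sub>v m"
    using hom_to_dual_eq_zero[OF not_self_dual] zero_mat_mult_vec[OF v] v by force
  have "\<exists>M\<in>hom_space G m (dual_rep G \<sigma>) m \<sigma>. \<forall>v\<in>carrier_vec m. fst (\<Phi> (0\<^sub>v m, v)) = M *\<^sub>v v"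
    by (rule equivariant_linear_map_is_hom[OF sigma_dual_carrier sigma_carrier, where f = "\<lambda>v. fst (\<Phi> (0\<^sub>v m, v))"])
      (use component_carrier partial(1-4) commutes_partial(2) in \<open>auto simp: vpair_add_def vpair_smult_def\<close>)
  then show "fst (\<Phi> (0\<^sub>v m, v)) = 0\<^sub>v m"
    using hom_from_dual_eq_zero[OF not_self_dual] zero_mat_mult_vec[OF v] v by force
qed

lemma block_diagonal:
  obtains MV MD where "MV \<in> hom_space G m \<sigma> m \<sigma>" and "MD \<in> hom_space G m (dual_rep G \<sigma>) m (dual_rep G \<sigma>)"
    and "\<And>v f. v \<in> carrier_vec m \<Longrightarrow> f \<in> carrier_vec m \<Longrightarrow> \<Phi> (v, f) = (MV *\<^sub>v v, MD *\<^sub>v f)"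
proof -
  note partial = clinear_on_pair_partial[OF \<Phi>_clinear]
  have "\<exists>M\<in>hom_space G m \<sigma> m \<sigma>. \<forall>v\<in>carrier_vec m. fst (\<Phi> (v, 0\<^sub>v m)) = M *\<^sub>v v"
    by (rule equivariant_linear_map_is_hom[OF sigma_carrier sigma_carrier, where f = "\<lambda>v. fst (\<Phi> (v, 0\<^sub>v m))"])
      (use component_carrier partial(1-4) commutes_partial(1) in \<open>auto simp: vpair_add_def vpair_smult_def\<close>)
  then obtain MV where MV: "MV \<in> hom_space G m \<sigma> m \<sigma>"
    and MV_eq: "\<And>v. v \<in> carrier_vec m \<Longrightarrow> fst (\<Phi> (v, 0\<^sub>v m)) = MV *\<^sub>v v"
    by blast
  have "\<exists>M\<in>hom_space G m (dual_rep G \<sigma>) m (dual_rep G \<sigma>). \<forall>f\<in>carrier_vec m. snd (\<Phi> (0\<^sub>v m, f)) = M *\<^sub>v f"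
    by (rule equivariant_linear_map_is_hom[OF sigma_dual_carrier sigma_dual_carrier, where f = "\<lambda>v. snd (\<Phi> (0\<^sub>v m, v))"])
      (use component_carrier partial(1-4) commutes_partial(2) in \<open>auto simp: vpair_add_def vpair_smult_def\<close>)
  then obtain MD where MD: "MD \<in> hom_space G m (dual_rep G \<sigma>) m (dual_rep G \<sigma>)"
    and MD_eq: "\<And>f. f \<in> carrier_vec m \<Longrightarrow> snd (\<Phi> (0\<^sub>v m, f)) = MD *\<^sub>v f"
    by blast
  have "\<Phi> (v, f) = (MV *\<^sub>v v, MD *\<^sub>v f)" if "v \<in> carrier_vec m" "f \<in> carrier_vec m" for v f
    using partial(5)[OF that] that MV_eq MD_eq off_diagonal_blocks_zero hom_spaceD(1)[OF MV] hom_spaceD(1)[OF MD]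
    by (simp add: vpair_add_def)
  with MV MD show thesis by (rule that)
qed

end

theorem proposition3p10:
  fixes G :: "('g, 'b) monoid_scheme" and T :: "'g topology"
    and r :: nat and \<rho> :: "'g \<Rightarrow> complex mat"
    and m :: nat and \<sigma> :: "'g \<Rightarrow> complex mat"
    and \<Phi> :: "complex vec \<times> complex vec \<Rightarrow> complex vec \<times> complex vec"
  defines "H \<equiv> hom_space G r \<rho> m \<sigma>"
    and "Hd \<equiv> hom_space G r (dual_rep G \<rho>) m (dual_rep G \<sigma>)"
    and "VV \<equiv> carrier_vec m \<times> carrier_vec m"
  assumes G0: "compact_group G T"
    and R_rep: "unitary_rep G T r \<rho>" and R_irr: "irreducible_rep G r \<rho>"
    and V_rep: "unitary_rep G T m \<sigma>"
    and V_isotypic: "\<forall>W. irreducible_subrep G m \<sigma> W \<longrightarrow> rep_iso_to G r \<rho> m \<sigma> W"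
    and R_not_self_dual: "\<not> rep_iso_to G r \<rho> r (dual_rep G \<rho>) (carrier_vec r)"
    and \<Phi>_maps: "\<Phi> ` VV \<subseteq> VV"
    and \<Phi>_linear: "clinear_on VV \<Phi> vpair_add vpair_smult vpair_add vpair_smult"
    and \<Phi>_equivariant: "\<forall>g\<in>carrier G. \<forall>v\<in>carrier_vec m. \<forall>f\<in>carrier_vec m.
          \<Phi> (\<sigma> g *\<^sub>v v, dual_rep G \<sigma> g *\<^sub>v f)
            = (\<sigma> g *\<^sub>v fst (\<Phi> (v, f)), dual_rep G \<sigma> g *\<^sub>v snd (\<Phi> (v, f)))"
  shows "(\<exists>A D. A ` H \<subseteq> H \<and> clinear_on H A (+) (\<cdot>\<^sub>m) (+) (\<cdot>\<^sub>m)
            \<and> D ` Hd \<subseteq> Hd \<and> clinear_on Hd D (+) (\<cdot>\<^sub>m) (+) (\<cdot>\<^sub>m)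
            \<and> (\<forall>h\<in>H. \<forall>x\<in>carrier_vec r. \<Phi> (h *\<^sub>v x, 0\<^sub>v m) = (A h *\<^sub>v x, 0\<^sub>v m))
            \<and> (\<forall>f\<in>Hd. \<forall>t\<in>carrier_vec r. \<Phi> (0\<^sub>v m, f *\<^sub>v t) = (0\<^sub>v m, D f *\<^sub>v t)))
       \<and> (\<forall>A D. A ` H \<subseteq> H \<and> clinear_on H A (+) (\<cdot>\<^sub>m) (+) (\<cdot>\<^sub>m)
            \<and> D ` Hd \<subseteq> Hd \<and> clinear_on Hd D (+) (\<cdot>\<^sub>m) (+) (\<cdot>\<^sub>m)
            \<and> (\<forall>h\<in>H. \<forall>x\<in>carrier_vec r. \<Phi> (h *\<^sub>v x, 0\<^sub>v m) = (A h *\<^sub>v x, 0\<^sub>v m))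
            \<and> (\<forall>f\<in>Hd. \<forall>t\<in>carrier_vec r. \<Phi> (0\<^sub>v m, f *\<^sub>v t) = (0\<^sub>v m, D f *\<^sub>v t))
          \<longrightarrow> (respects_isometry VV form_b \<Phi>
                 \<longleftrightarrow> respects_isometry (H \<times> Hd) (form_s r) (\<lambda>(h, f). (A h, D f)))
            \<and> (respects_infinitesimally VV form_b \<Phi>
                 \<longleftrightarrow> respects_infinitesimally (H \<times> Hd) (form_s r) (\<lambda>(h, f). (A h, D f))))"
proof -
  interpret equivariant_pair_map G T r \<rho> m \<sigma> \<Phi>
    using G0 R_rep R_irr V_rep V_isotypic R_not_self_dual \<Phi>_maps \<Phi>_linear \<Phi>_equivariant
    unfolding compact_group_def VV_def
    by (intro equivariant_pair_map.intro isotypic_rep.intro equivariant_pair_map_axioms.intro) auto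
  obtain MV MD where MV: "MV \<in> hom_space G m \<sigma> m \<sigma>"
    and MD: "MD \<in> hom_space G m (dual_rep G \<sigma>) m (dual_rep G \<sigma>)"
    and \<Phi>_eq: "\<And>v f. v \<in> carrier_vec m \<Longrightarrow> f \<in> carrier_vec m \<Longrightarrow> \<Phi> (v, f) = (MV *\<^sub>v v, MD *\<^sub>v f)"
    using block_diagonal by blast
  note left_mult = left_mult_block_maps[OF MV MD \<Phi>_eq]
  have MVc: "MV \<in> carrier_mat m m" and MDc: "MD \<in> carrier_mat m m" using MV MD by (auto dest: hom_spaceD)
  show ?thesis
  proof (intro conjI allI impI)
    show "\<exists>A D. A ` H \<subseteq> H \<and> clinear_on H A (+) (\<cdot>\<^sub>m) (+) (\<cdot>\<^sub>m)
            \<and> D ` Hd \<subseteq> Hd \<and> clinear_on Hd D (+) (\<cdot>\<^sub>m) (+) (\<cdot>\<^sub>m)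
            \<and> (\<forall>h\<in>H. \<forall>x\<in>carrier_vec r. \<Phi> (h *\<^sub>v x, 0\<^sub>v m) = (A h *\<^sub>v x, 0\<^sub>v m))
            \<and> (\<forall>f\<in>Hd. \<forall>t\<in>carrier_vec r. \<Phi> (0\<^sub>v m, f *\<^sub>v t) = (0\<^sub>v m, D f *\<^sub>v t))"
      using left_mult unfolding H_def Hd_def by (intro exI[of _ "(*) MV"] exI[of _ "(*) MD"]) auto
  next
    fix A D assume AD: "A ` H \<subseteq> H \<and> clinear_on H A (+) (\<cdot>\<^sub>m) (+) (\<cdot>\<^sub>m)
            \<and> D ` Hd \<subseteq> Hd \<and> clinear_on Hd D (+) (\<cdot>\<^sub>m) (+) (\<cdot>\<^sub>m)
            \<and> (\<forall>h\<in>H. \<forall>x\<in>carrier_vec r. \<Phi> (h *\<^sub>v x, 0\<^sub>v m) = (A h *\<^sub>v x, 0\<^sub>v m))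
            \<and> (\<forall>f\<in>Hd. \<forall>t\<in>carrier_vec r. \<Phi> (0\<^sub>v m, f *\<^sub>v t) = (0\<^sub>v m, D f *\<^sub>v t))"
    have "A h = MV * h" if h: "h \<in> H" for h
      using AD h MVc left_mult(5)[of h] unfolding H_def
      by (intro eq_mat_by_mult_vecI[of _ m r]) (auto dest: hom_spaceD)
    moreover have "D f = MD * f" if f: "f \<in> Hd" for f
      using AD f MDc left_mult(6)[of f] unfolding Hd_def
      by (intro eq_mat_by_mult_vecI[of _ m r]) (auto dest: hom_spaceD)
    ultimately show "respects_isometry VV form_b \<Phi> \<longleftrightarrow> respects_isometry (H \<times> Hd) (form_s r) (\<lambda>(h, f). (A h, D f))"
      and "respects_infinitesimally VV form_b \<Phi> \<longleftrightarrow> respects_infinitesimally (H \<times> Hd) (form_s r) (\<lambda>(h, f). (A h, D f))"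
      using block_diagonal_respects_forms_iff[OF MV MD \<Phi>_eq] unfolding VV_def H_def Hd_def by blast+
  qed
qed

end
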